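(* Let $1<p<\infty$ and let $J$ be $\mathbb{R}_-$ or $\mathbb{R}_+$. If $w\in A_p^+(J)$, then $\inf\{q>1: w\in A_q^+(J)\}<p$. Likewise, if $w\in A_p^-(J)$, then $\inf\{q>1: w\in A_q^-(J)\}<p$.
   Context: $\mathbb{R}_-=(-\infty,0]$, $\mathbb{R}_+=[0,\infty)$. A weight on $J$ is a measurable function $w:J\to[0,\infty)$ with $w>0$ a.e. For $q\in(1,\infty)$, $q'=q/(q-1)$, and with suprema running over all $a<b<c$ in $J$ (i.e. $a<b<c\le 0$ if $J=\mathbb{R}_-$, $0\le a<b<c$ if $J=\mathbb{R}_+$), a weight $w$ on $J$ belongs to $A_q^+(J)$ if $\sup\frac1{(c-a)^q}\int_a^bw\,dt\big(\int_b^cw^{1-q'}dt\big)^{q-1}<\infty$, and to $A_q^-(J)$ if $\sup\frac1{(c-a)^q}\int_b^cw\,dt\big(\int_a^bw^{1-q'}dt\big)^{q-1}<\infty$. *)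

theory Defs
  imports "HOL-Analysis.Analysis"
begin

text \<open>A weight on \<open>J\<close> is represented by a function on the whole line; only its values
  on \<open>J\<close> matter. Measurability and null sets are in the sense of Lebesgue.\<close>

definition weight_on :: "real set \<Rightarrow> (real \<Rightarrow> real) \<Rightarrow> bool" where
  "weight_on J w \<longleftrightarrow>
     w \<in> borel_measurable (lebesgue_on J) \<and> (\<forall>x\<in>J. 0 \<le> w x) \<and> (AE x in lebesgue_on J. 0 < w x)"

definition conjugate_exponent :: "real \<Rightarrow> real" where
  "conjugate_exponent q = q / (q - 1)"

text \<open>The power of an extended nonnegative real by a positive real exponent; the integrals
  in the definitions below may be infinite.\<close>

definition ennreal_powr :: "ennreal \<Rightarrow> real \<Rightarrow> ennreal" where
  "ennreal_powr x r = (if x = \<infinity> then \<infinity> else ennreal (enn2real x powr r))"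

text \<open>The integrand \<open>w t powr (1 - q')\<close> has a negative exponent and takes the library value
  \<open>0\<close> (rather than \<open>\<infinity>\<close>) where \<open>w t = 0\<close>; for a weight this is a null set.
  For a weight no product \<open>0 * \<infinity>\<close> occurs, since all integrals below are positive.\<close>

definition A_plus :: "real \<Rightarrow> real set \<Rightarrow> (real \<Rightarrow> real) set" where
  "A_plus q J = {w. weight_on J w \<and>
     (SUP (a, b, c) \<in> {(a, b, c). a \<in> J \<and> b \<in> J \<and> c \<in> J \<and> a < b \<and> b < c}.
        ennreal (1 / (c - a) powr q)
        * (\<integral>\<^sup>+t\<in>{a..b}. ennreal (w t) \<partial>lebesgue)
        * ennreal_powr (\<integral>\<^sup>+t\<in>{b..c}. ennreal (w t powr (1 - conjugate_exponent q)) \<partial>lebesgue) (q - 1))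
     < \<infinity>}"

definition A_minus :: "real \<Rightarrow> real set \<Rightarrow> (real \<Rightarrow> real) set" where
  "A_minus q J = {w. weight_on J w \<and>
     (SUP (a, b, c) \<in> {(a, b, c). a \<in> J \<and> b \<in> J \<and> c \<in> J \<and> a < b \<and> b < c}.
        ennreal (1 / (c - a) powr q)
        * (\<integral>\<^sup>+t\<in>{b..c}. ennreal (w t) \<partial>lebesgue)
        * ennreal_powr (\<integral>\<^sup>+t\<in>{a..b}. ennreal (w t powr (1 - conjugate_exponent q)) \<partial>lebesgue) (q - 1))
     < \<infinity>}"

end

theory Submission
  imports Defs
begin

text \<open>
  The condition \<open>A\<^sub>p\<^sup>+\<close> improves itself because the dual weight \<open>\<sigma> = w powr (1 - p')\<close> satisfies a
  one-sided reverse Hoelder inequality. After \<open>w\<close> has been changed on a null set, both weights are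
  positive everywhere; let \<open>F\<close> be a primitive of \<open>\<sigma>\<close>.

  Suppose that all averages of \<open>\<sigma>\<close> over intervals \<open>{x..y}\<close> with \<open>y \<in> {x..c}\<close> are at most
  \<open>l\<^sub>0\<close>, and let \<open>l \<ge> l\<^sub>0\<close>. F. Riesz's rising sun construction yields disjoint
  intervals \<open>I = {\<alpha><..<\<beta>}\<close> outside of which \<open>\<sigma> \<le> l\<close> almost everywhere in \<open>{x..c}\<close>, on which
  the average of \<open>\<sigma>\<close> is at most \<open>l\<close>, and such that the average of \<open>\<sigma>\<close> over every
  \<open>{t..\<beta>}\<close> is at least \<open>l\<close>. Thus the right half of \<open>I\<close> carries at least half of the mass
  \<open>l * (\<beta> - \<alpha>)\<close>, so \<open>A\<^sub>p\<^sup>+\<close> bounds the average of \<open>w\<close> over the left half by a multiple of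
  \<open>l powr (1 - p)\<close>, and by Chebyshev's inequality \<open>\<sigma> > \<eta> * l\<close> on at least a quarter of \<open>I\<close>
  (\<open>measure_level_component\<close>). Summation over the intervals (\<open>rising_sun_level\<close>) gives
  \<open>\<integral>{\<sigma> > l} \<sigma> \<le> 4 * l * |{\<sigma> > \<eta> * l}|\<close>. This forces \<open>\<integral>{\<sigma> > l} \<sigma>\<close> to decay
  like a negative power of \<open>l\<close>, whence \<open>\<integral> \<sigma> powr (1 + d) \<le> C * l\<^sub>0 powr d * \<integral> \<sigma>\<close> on \<open>{x..c}\<close>
  for some \<open>d > 0\<close> (\<open>reverse_holder_one_sided\<close>).

  Now let \<open>a < b < c\<close>. Split \<open>{a..b}\<close> at \<open>b\<^sub>1 < b\<^sub>2\<close> into three pieces of equal \<open>w\<close>-mass. A weak type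
  estimate for the one-sided maximal function (\<open>exists_slope_start\<close>) provides a point
  \<open>x \<in> {b\<^sub>1..b\<^sub>2}\<close> from which the averages of \<open>\<sigma>\<close> are bounded by a multiple of
  \<open>(\<sigma>{b\<^sub>1..c} / w{a..b}) powr (1/p)\<close>. The reverse Hoelder inequality on \<open>{x..c}\<close>, together with \<open>A\<^sub>p\<^sup>+\<close> for
  the triple \<open>(a, b\<^sub>1, c)\<close>, then gives the bound of \<open>A\<^sub>q\<^sup>+\<close> for \<open>(a, b, c)\<close>, where
  \<open>q = 1 + (p - 1) / (1 + d) < p\<close>. The class \<open>A\<^sub>p\<^sup>-\<close> reduces to \<open>A\<^sub>p\<^sup>+\<close> by the reflection
  \<open>t \<mapsto> - t\<close>.
\<close>

section \<open>Open subsets of the line and their components\<close>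

lemma interval_sets_lebesgue [measurable]:
  "{u..v::real} \<in> sets lebesgue" "{u<..<v} \<in> sets lebesgue"
  by auto

lemma emeasure_open_le_components:
  fixes U :: "real set"
  assumes U: "open U" and sets: "sets M = sets lebesgue" "sets N = sets lebesgue"
    and le: "\<And>C. C \<in> components U \<Longrightarrow> emeasure M C \<le> emeasure N C"
  shows "emeasure M U \<le> emeasure N U"
proof -
  have op: "open C" if "C \<in> components U" for C
    using that U open_components by blast
  have cnt: "countable (components U)"
  proof (rule countable_disjoint_open_subsets)
    show "disjoint (components U)"
      using pairwise_disjoint_components by (metis (mono_tags, lifting) disjnt_def pairwiseI pairwiseD)
  qed (use op in auto)
  have disj: "disjoint_family_on (\<lambda>C. C) (components U)"
    using pairwise_disjoint_components[of U] by (auto simp: disjoint_family_on_def pairwise_def)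
  have meas: "C \<in> sets M" "C \<in> sets N" if "C \<in> components U" for C
    using op[OF that] sets by auto
  have "emeasure M (\<Union>((\<lambda>C. C) ` components U)) \<le> emeasure N (\<Union>((\<lambda>C. C) ` components U))"
    by (subst (1 2) emeasure_UN_countable) (auto intro!: nn_integral_mono le meas cnt disj)
  then show ?thesis
    by (simp add: Union_components)
qed

lemma component_open_real:
  fixes U :: "real set"
  assumes U: "open U" "U \<subseteq> {a<..<b}" and C: "C \<in> components U"
  obtains u v where "u < v" "C = {u<..<v}" "u \<notin> U" "v \<notin> U" "a \<le> u" "v \<le> b"
proof -
  have op: "open C" and con: "connected C" and ne: "C \<noteq> {}" and sub: "C \<subseteq> U"
    using open_components[OF U(1) C] in_components_connected[OF C] in_components_nonempty[OF C]
      in_components_subset[OF C] by simp_all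
  have bdd: "bdd_below C" "bdd_above C"
    using sub U by (auto intro!: bdd_belowI[of _ a] bdd_aboveI[of _ b])
  define u v where "u = Inf C" and "v = Sup C"
  have uC: "u \<notin> C"
  proof
    assume "u \<in> C"
    then obtain d where "0 < d" "ball u d \<subseteq> C"
      using op by (meson open_contains_ball)
    then have "u - d/2 \<in> C"
      by (auto simp: dist_real_def subset_iff)
    then have "u \<le> u - d/2"
      unfolding u_def using bdd by (intro cInf_lower)
    with \<open>0 < d\<close> show False by simp
  qed
  have vC: "v \<notin> C"
  proof
    assume "v \<in> C"
    then obtain d where "0 < d" "ball v d \<subseteq> C"
      using op by (meson open_contains_ball)
    then have "v + d/2 \<in> C"
      by (auto simp: dist_real_def subset_iff)
    then have "v + d/2 \<le> v"
      unfolding v_def using bdd by (intro cSup_upper)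
    with \<open>0 < d\<close> show False by simp
  qed
  have C_eq: "C = {u<..<v}"
  proof (intro equalityI subsetI)
    fix x assume x: "x \<in> C"
    then have "u \<le> x" "x \<le> v"
      unfolding u_def v_def using bdd by (auto intro: cInf_lower cSup_upper)
    moreover have "x \<noteq> u" "x \<noteq> v"
      using x uC vC by auto
    ultimately show "x \<in> {u<..<v}" by auto
  next
    fix x assume x: "x \<in> {u<..<v}"
    then obtain y z where "y \<in> C" "y < x" "z \<in> C" "x < z"
      unfolding u_def v_def using bdd ne
      by (auto simp: cInf_less_iff less_cSup_iff)
    then show "x \<in> C"
      using con unfolding connected_iff_interval by (meson less_imp_le)
  qed
  have uv: "u < v"
    using ne C_eq by auto
  have "u \<notin> U"
  proof
    assume "u \<in> U"
    then have "{u..<v} \<subseteq> U"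
      using sub C_eq by (auto simp: order_le_less)
    moreover have "C \<inter> {u..<v} \<noteq> {}"
      using ne C_eq by (metis Int_absorb2 greaterThanLessThan_subseteq_atLeastLessThan_iff order_refl)
    ultimately have "{u..<v} \<subseteq> C"
      using components_maximal[OF C, of "{u..<v}"] by simp
    with uC uv show False by auto
  qed
  moreover have "v \<notin> U"
  proof
    assume "v \<in> U"
    then have "{u<..v} \<subseteq> U"
      using sub C_eq by (auto simp: order_le_less)
    moreover have "C \<inter> {u<..v} \<noteq> {}"
      using ne C_eq by (metis Int_absorb2 greaterThanLessThan_subseteq_greaterThanAtMost_iff order_refl)
    ultimately have "{u<..v} \<subseteq> C"
      using components_maximal[OF C, of "{u<..v}"] by simp
    with vC uv show False by auto
  qed
  moreover have "a \<le> u" "v \<le> b"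
  proof -
    show "a \<le> u" unfolding u_def using ne sub U by (intro cInf_greatest) (auto simp: less_imp_le)
    show "v \<le> b" unfolding v_def using ne sub U by (intro cSup_least) (auto simp: less_imp_le)
  qed
  ultimately show thesis
    using that uv C_eq by blast
qed

section \<open>Primitives of positive functions\<close>

text \<open>\<open>F\<close> is a continuous primitive of the nonnegative function \<open>f\<close> on the interval \<open>I\<close>: the mass that \<open>f\<close>
  gives to a subinterval is the increment of \<open>F\<close>. Monotonicity is required explicitly, since
  \<open>ennreal\<close> truncates negative increments to \<open>0\<close>.\<close>

definition primitive_on :: "real set \<Rightarrow> (real \<Rightarrow> real) \<Rightarrow> (real \<Rightarrow> real) \<Rightarrow> bool" where
  "primitive_on I f F \<longleftrightarrow> continuous_on I F \<and>
     (\<forall>u\<in>I. \<forall>v\<in>I. u \<le> v \<longrightarrow>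
        F u \<le> F v \<and> (\<integral>\<^sup>+t\<in>{u..v}. ennreal (f t) \<partial>lebesgue) = ennreal (F v - F u))"

lemma primitive_on_mono:
  assumes "primitive_on I f F" "u \<in> I" "v \<in> I" "u \<le> v"
  shows "F u \<le> F v"
  using assms unfolding primitive_on_def by blast

lemma primitive_on_nn_integral:
  assumes "primitive_on I f F" "u \<in> I" "v \<in> I" "u \<le> v"
  shows "(\<integral>\<^sup>+t\<in>{u..v}. ennreal (f t) \<partial>lebesgue) = ennreal (F v - F u)"
  using assms unfolding primitive_on_def by blast

lemma nn_integral_pos_interval:
  assumes [measurable]: "f \<in> borel_measurable lebesgue"
    and pos: "\<And>t. t \<in> {u..v} \<Longrightarrow> 0 < f t" and "(u::real) < v"
  shows "0 < (\<integral>\<^sup>+t\<in>{u..v}. ennreal (f t) \<partial>lebesgue)"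
proof (rule ccontr)
  assume "\<not> ?thesis"
  then have "AE t in lebesgue. ennreal (f t) * indicator {u..v} t = 0"
    by (subst (asm) not_gr_zero, subst (asm) nn_integral_0_iff_AE) auto
  then have "AE t in lebesgue. t \<notin> {u..v}"
    by eventually_elim (use pos in \<open>fastforce simp: indicator_def ennreal_eq_0_iff not_le\<close>)
  then have "{u..v} \<in> null_sets lebesgue"
    by (subst (asm) AE_iff_null_sets[symmetric]) auto
  with \<open>u < v\<close> show False
    by (auto simp: null_sets_def)
qed

lemma primitive_on_strict_mono:
  assumes "primitive_on I f F" "f \<in> borel_measurable lebesgue" "\<And>t. t \<in> {u..v} \<Longrightarrow> 0 < f t"
    and "u \<in> I" "v \<in> I" "u < v"
  shows "F u < F v"
proof -
  have "0 < (\<integral>\<^sup>+t\<in>{u..v}. ennreal (f t) \<partial>lebesgue)"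
    by (rule nn_integral_pos_interval) (use assms in auto)
  also have "\<dots> = ennreal (F v - F u)"
    by (rule primitive_on_nn_integral) (use assms in auto)
  finally show ?thesis by (simp add: ennreal_less_zero_iff)
qed

lemma primitive_on_subset:
  "primitive_on I f F \<Longrightarrow> I' \<subseteq> I \<Longrightarrow> primitive_on I' f F"
  unfolding primitive_on_def by (blast intro: continuous_on_subset)

lemma exists_primitive_on:
  fixes f :: "real \<Rightarrow> real"
  assumes f [measurable]: "f \<in> borel_measurable lebesgue" and pos: "\<And>t. 0 \<le> f t"
    and fin: "(\<integral>\<^sup>+t\<in>{a..b}. ennreal (f t) \<partial>lebesgue) < \<infinity>"
  shows "\<exists>F. primitive_on {a..b} f F"
proof -
  have HI: "(f has_integral enn2real (\<integral>\<^sup>+t\<in>{u..v}. ennreal (f t) \<partial>lebesgue)) {u..v}"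
    and fin': "(\<integral>\<^sup>+t\<in>{u..v}. ennreal (f t) \<partial>lebesgue) < \<infinity>"
    if "a \<le> u" "v \<le> b" for u v
  proof -
    have "(\<integral>\<^sup>+t\<in>{u..v}. ennreal (f t) \<partial>lebesgue) \<le> (\<integral>\<^sup>+t\<in>{a..b}. ennreal (f t) \<partial>lebesgue)"
      using that by (intro nn_integral_mono) (auto simp: indicator_def)
    then show fin': "(\<integral>\<^sup>+t\<in>{u..v}. ennreal (f t) \<partial>lebesgue) < \<infinity>"
      using fin by (rule le_less_trans)
    let ?g = "\<lambda>t. if t \<in> {u..v} then f t else 0"
    have g: "?g \<in> borel_measurable lebesgue"
      by measurable
    have "(\<integral>\<^sup>+t. ennreal (?g t) \<partial>lebesgue) = (\<integral>\<^sup>+t\<in>{u..v}. ennreal (f t) \<partial>lebesgue)"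
      by (intro nn_integral_cong) (auto simp: indicator_def)
    then have "(?g has_integral enn2real (\<integral>\<^sup>+t\<in>{u..v}. ennreal (f t) \<partial>lebesgue)) UNIV"
      using fin' g by (subst has_integral_iff_nn_integral_lebesgue) (auto simp: pos)
    then show "(f has_integral enn2real (\<integral>\<^sup>+t\<in>{u..v}. ennreal (f t) \<partial>lebesgue)) {u..v}"
      by (simp only: has_integral_restrict_UNIV)
  qed
  have int: "f integrable_on {u..v}" if "a \<le> u" "v \<le> b" for u v
    using HI[OF that] by blast
  let ?F = "\<lambda>t. integral {a..t} f"
  have "continuous_on {a..b} ?F"
    by (intro indefinite_integral_continuous_1 int) auto
  moreover have "?F u \<le> ?F v \<and> (\<integral>\<^sup>+t\<in>{u..v}. ennreal (f t) \<partial>lebesgue) = ennreal (?F v - ?F u)"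
    if uv: "u \<in> {a..b}" "v \<in> {a..b}" "u \<le> v" for u v
  proof -
    have "?F u + integral {u..v} f = ?F v"
      by (rule Henstock_Kurzweil_Integration.integral_combine) (use uv int in auto)
    moreover have "integral {u..v} f = enn2real (\<integral>\<^sup>+t\<in>{u..v}. ennreal (f t) \<partial>lebesgue)"
      using HI[of u v] uv by (auto simp: integral_unique)
    ultimately have *: "?F v - ?F u = enn2real (\<integral>\<^sup>+t\<in>{u..v}. ennreal (f t) \<partial>lebesgue)"
      by simp
    then have "?F u \<le> ?F v"
      by (metis diff_ge_0_iff_ge enn2real_nonneg)
    with * show ?thesis
      using fin'[of u v] uv by (simp only: *) auto
  qed
  ultimately show ?thesis
    unfolding primitive_on_def by blast
qed

section \<open>The rising sun lemma\<close>

text \<open>Where all difference quotients of \<open>F\<close> to the right are at most \<open>l\<close>, its density is at most \<open>l\<close>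
  almost everywhere. This needs no differentiation theorem: cover the exceptional set \<open>E\<close> by a
  slightly larger open set. The part of \<open>E\<close> in a component \<open>{u<..<v}\<close> lies in \<open>{s..v}\<close>,
  where \<open>s\<close> is its infimum, and the mass of \<open>{s..v}\<close> is at most \<open>l * (v - s)\<close>.\<close>

lemma null_set_slope:
  assumes [measurable]: "f \<in> borel_measurable lebesgue" and F: "primitive_on {x..c} f F"
    and E [measurable]: "E \<in> sets lebesgue" and Esub: "E \<subseteq> {x<..<c}" and l: "0 \<le> l"
    and big: "\<And>t. t \<in> E \<Longrightarrow> l < f t"
    and slope: "\<And>t y. t \<in> E \<Longrightarrow> y \<in> {t..c} \<Longrightarrow> F y - F t \<le> l * (y - t)"
  shows "E \<in> null_sets lebesgue"
proof -
  define M where "M = density lebesgue (\<lambda>t. ennreal (f t) * indicator E t)"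
  define N where "N = density lebesgue (\<lambda>t::real. ennreal l)"
  have finE: "emeasure lebesgue E < \<infinity>"
  proof -
    have "emeasure lebesgue E \<le> emeasure lebesgue {x..c}"
      using Esub by (intro emeasure_mono) auto
    also have "\<dots> < \<infinity>"
      by (simp add: emeasure_lborel_Icc_eq)
    finally show ?thesis .
  qed
  have comp: "emeasure M C \<le> emeasure N C" if U: "open U" "U \<subseteq> {x<..<c}" "C \<in> components U" for U C
  proof -
    obtain u v where uv: "u < v" "C = {u<..<v}" "x \<le> u" "v \<le> c"
      using component_open_real[OF U] by metis
    show ?thesis
    proof (cases "E \<inter> C = {}")
      case True
      then have zero: "ennreal (f t) * indicator E t * indicator C t = 0" for t
        by (auto simp: indicator_def)
      have "emeasure M C = (\<integral>\<^sup>+t. ennreal (f t) * indicator E t * indicator C t \<partial>lebesgue)"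
        unfolding M_def uv by (subst emeasure_density) auto
      also have "\<dots> = 0"
        unfolding zero by simp
      finally show ?thesis by simp
    next
      case False
      define s where "s = Inf (E \<inter> C)"
      have bdd: "bdd_below (E \<inter> C)"
        using uv by (auto intro!: bdd_belowI[of _ u])
      have s: "u \<le> s"
        unfolding s_def using False uv by (intro cInf_greatest) auto
      obtain t0 where t0: "t0 \<in> E" "t0 \<in> C" using False by auto
      have "s \<le> t0"
        unfolding s_def using t0 bdd by (intro cInf_lower) auto
      with t0 uv have "s < v" by auto
      \<comment> \<open>The slope bound at points of \<open>E\<close> passes to the limit point \<open>s\<close> by continuity of \<open>F\<close>.\<close>
      define Z where "Z = {t \<in> {u..v}. F v - F t \<le> l * (v - t)}"
      have "closed Z"
      proof -
        have "continuous_on {u..v} F"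
          using F uv unfolding primitive_on_def by (auto intro: continuous_on_subset)
        then show ?thesis
          unfolding Z_def
          by (intro continuous_on_closed_Collect_le continuous_intros) auto
      qed
      moreover have "E \<inter> C \<subseteq> Z"
        using slope uv by (force simp: Z_def)
      moreover have "s \<in> closure (E \<inter> C)"
        unfolding s_def using False bdd by (intro closure_contains_Inf)
      ultimately have "s \<in> Z"
        using closure_minimal by blast
      then have Fs: "F v - F s \<le> l * (v - s)"
        by (simp add: Z_def)
      have "emeasure M C = (\<integral>\<^sup>+t. ennreal (f t) * indicator E t * indicator C t \<partial>lebesgue)"
        unfolding M_def uv by (subst emeasure_density) auto
      also have "\<dots> \<le> (\<integral>\<^sup>+t\<in>{s..v}. ennreal (f t) \<partial>lebesgue)"
        using uv bdd unfolding s_def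
        by (intro nn_integral_mono) (auto simp: indicator_def intro!: cInf_lower)
      also have "\<dots> = ennreal (F v - F s)"
        using s \<open>s < v\<close> uv by (intro primitive_on_nn_integral[OF F]) auto
      also have "\<dots> \<le> ennreal (l * (v - u))"
        using Fs s l mult_left_mono[of "v - s" "v - u" l] by (intro ennreal_leI) linarith
      also have "\<dots> = emeasure N C"
        unfolding N_def uv using l uv
        by (simp add: emeasure_density nn_integral_cmult_indicator ennreal_mult)
      finally show ?thesis .
    qed
  qed
  have le_eps: "(\<integral>\<^sup>+t\<in>E. ennreal (f t) \<partial>lebesgue) \<le> ennreal l * emeasure lebesgue E + ennreal (l * e)"
    if e: "0 < e" for e
  proof -
    obtain T where T: "open T" "E \<subseteq> T" "(T - E) \<in> lmeasurable" "emeasure lebesgue (T - E) < ennreal e"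
      using sets_lebesgue_outer_open[OF E e] by blast
    define U where "U = T \<inter> {x<..<c}"
    have U: "open U" "U \<subseteq> {x<..<c}" "E \<subseteq> U" "U - E \<subseteq> T - E"
      using T Esub by (auto simp: U_def)
    have [measurable]: "U \<in> sets lebesgue" using U by auto
    have "(\<integral>\<^sup>+t\<in>E. ennreal (f t) \<partial>lebesgue) = emeasure M U"
      unfolding M_def using U
      by (subst emeasure_density) (auto intro!: nn_integral_cong simp: indicator_def)
    also have "\<dots> \<le> emeasure N U"
      by (rule emeasure_open_le_components[OF U(1) _ _ comp[OF U(1,2)]]) (simp_all add: M_def N_def)
    also have "\<dots> = ennreal l * emeasure lebesgue U"
      unfolding N_def by (simp add: emeasure_density nn_integral_cmult_indicator)
    also have "emeasure lebesgue U \<le> emeasure lebesgue E + emeasure lebesgue (T - E)"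
    proof -
      have "emeasure lebesgue U \<le> emeasure lebesgue (E \<union> (T - E))"
        using U T by (intro emeasure_mono) auto
      also have "\<dots> \<le> emeasure lebesgue E + emeasure lebesgue (T - E)"
        using T by (intro emeasure_subadditive) auto
      finally show ?thesis .
    qed
    also have "\<dots> \<le> emeasure lebesgue E + ennreal e"
      using T(4) by (intro add_left_mono) auto
    finally show ?thesis
      using l e by (simp add: ring_distribs ennreal_mult mult_left_mono)
  qed
  have "(\<integral>\<^sup>+t\<in>E. ennreal (f t) \<partial>lebesgue) \<le> ennreal l * emeasure lebesgue E"
  proof (rule ennreal_le_epsilon)
    fix e :: real assume "0 < e"
    then have "l * (e / (l + 1)) \<le> e"
      using l by (simp add: field_simps)
    then have "ennreal l * emeasure lebesgue E + ennreal (l * (e / (l + 1)))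
        \<le> ennreal l * emeasure lebesgue E + ennreal e"
      by (intro add_left_mono ennreal_leI)
    moreover have "0 < e / (l + 1)"
      using l \<open>0 < e\<close> by simp
    ultimately show "(\<integral>\<^sup>+t\<in>E. ennreal (f t) \<partial>lebesgue) \<le> ennreal l * emeasure lebesgue E + ennreal e"
      using le_eps order_trans by blast
  qed
  moreover have "(\<integral>\<^sup>+t\<in>E. ennreal (f t) \<partial>lebesgue) =
      ennreal l * emeasure lebesgue E + (\<integral>\<^sup>+t\<in>E. ennreal (f t - l) \<partial>lebesgue)"
  proof -
    have "(\<integral>\<^sup>+t\<in>E. ennreal (f t) \<partial>lebesgue) =
        (\<integral>\<^sup>+t. ennreal l * indicator E t + ennreal (f t - l) * indicator E t \<partial>lebesgue)"
    proof (intro nn_integral_cong)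
      fix t
      show "ennreal (f t) * indicator E t
          = ennreal l * indicator E t + ennreal (f t - l) * indicator E t"
        using big[of t] l ennreal_plus[of l "f t - l"] by (auto simp: indicator_def)
    qed
    also have "\<dots> = ennreal l * emeasure lebesgue E + (\<integral>\<^sup>+t\<in>E. ennreal (f t - l) \<partial>lebesgue)"
      by (subst nn_integral_add) (auto simp: nn_integral_cmult_indicator)
    finally show ?thesis .
  qed
  moreover have "ennreal l * emeasure lebesgue E < \<infinity>"
    using finE by (simp add: ennreal_mult_less_top)
  ultimately have "(\<integral>\<^sup>+t\<in>E. ennreal (f t - l) \<partial>lebesgue) = 0"
    using ennreal_add_left_cancel_le[of "ennreal l * emeasure lebesgue E" _ 0] by auto
  then have "AE t in lebesgue. ennreal (f t - l) * indicator E t = 0"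
    by (subst (asm) nn_integral_0_iff_AE) auto
  then have "AE t in lebesgue. t \<notin> E"
    by eventually_elim (use big in \<open>fastforce simp: indicator_def ennreal_eq_0_iff not_le\<close>)
  then show ?thesis
    by (subst (asm) AE_iff_null_sets[symmetric]) auto
qed

text \<open>In the application \<open>G\<close> is the set where \<open>f\<close> exceeds a fixed fraction of the level \<open>l\<close>. The intervals to
  which \<open>comp\<close> is applied are the components of the set \<open>\<Omega>\<close> of points from which \<open>F t - l * t\<close> is
  exceeded further to the right. The hypothesis \<open>start\<close> ensures that also a component that
  begins at \<open>x\<close> has mass at most \<open>l\<close> times its length.\<close>

lemma rising_sun_level:
  assumes f [measurable]: "f \<in> borel_measurable lebesgue" and F: "primitive_on {x..c} f F"
    and l: "0 < l"
    and start: "\<And>y. y \<in> {x..c} \<Longrightarrow> F y - F x \<le> l * (y - x)"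
    and G [measurable]: "G \<in> sets lebesgue"
    and comp: "\<And>\<alpha> \<beta>. x \<le> \<alpha> \<Longrightarrow> \<alpha> < \<beta> \<Longrightarrow> \<beta> \<le> c \<Longrightarrow>
      (\<And>t. t \<in> {\<alpha><..\<beta>} \<Longrightarrow> l * (\<beta> - t) \<le> F \<beta> - F t) \<Longrightarrow>
      ennreal (\<beta> - \<alpha>) \<le> 4 * emeasure lebesgue ({\<alpha><..<\<beta>} \<inter> G)"
  shows "(\<integral>\<^sup>+t\<in>{t \<in> {x..c}. l < f t}. ennreal (f t) \<partial>lebesgue)
    \<le> 4 * ennreal l * emeasure lebesgue ({x..c} \<inter> G)"
proof -
  define H where "H = (\<lambda>t. F t - l * t)"
  have H: "continuous_on {x..c} H"
    using F unfolding H_def primitive_on_def by (auto intro!: continuous_intros)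
  define \<Omega> where "\<Omega> = (\<Union>y\<in>{x..c}. ({x<..<c} \<inter> H -` {..<H y}) \<inter> {..<y})"
  have \<Omega>: "t \<in> \<Omega> \<longleftrightarrow> t \<in> {x<..<c} \<and> (\<exists>y\<in>{t<..c}. H t < H y)" for t
    by (auto simp: \<Omega>_def)
  have \<Omega>_sub: "\<Omega> \<subseteq> {x<..<c}"
    by (auto simp: \<Omega>_def)
  have \<Omega>_open: "open \<Omega>"
    unfolding \<Omega>_def
    by (intro open_UN ballI open_Int continuous_open_preimage continuous_on_subset[OF H]) auto
  have [measurable]: "\<Omega> \<in> sets lebesgue"
    using \<Omega>_open by auto
  define S where "S = density lebesgue (\<lambda>t. ennreal (f t))"
  define N where "N = density lebesgue (\<lambda>t. 4 * ennreal l * indicator G t)"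
  have N: "emeasure N A = 4 * ennreal l * emeasure lebesgue (A \<inter> G)"
    if [measurable]: "A \<in> sets lebesgue" for A
  proof -
    have "emeasure N A = (\<integral>\<^sup>+t. 4 * ennreal l * indicator (A \<inter> G) t \<partial>lebesgue)"
      unfolding N_def
      by (subst emeasure_density) (auto intro!: nn_integral_cong simp: indicator_def)
    also have "\<dots> = 4 * ennreal l * emeasure lebesgue (A \<inter> G)"
      by (rule nn_integral_cmult_indicator) measurable
    finally show ?thesis .
  qed
  have SN: "emeasure S C \<le> emeasure N C" if C: "C \<in> components \<Omega>" for C
  proof -
    obtain \<alpha> \<beta> where ab: "\<alpha> < \<beta>" "C = {\<alpha><..<\<beta>}" "\<alpha> \<notin> \<Omega>" "\<beta> \<notin> \<Omega>" "x \<le> \<alpha>" "\<beta> \<le> c"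
      using component_open_real[OF \<Omega>_open \<Omega>_sub C] by metis
    have C_sub: "C \<subseteq> \<Omega>"
      using C by (rule in_components_subset)
    \<comment> \<open>A maximum of \<open>H\<close> over \<open>{t..\<beta>}\<close> left of \<open>\<beta>\<close> would be exceeded beyond \<open>\<beta>\<close>, which \<open>\<beta> \<notin> \<Omega>\<close> excludes.\<close>
    have max: "H t \<le> H \<beta>" if t: "t \<in> {\<alpha><..<\<beta>}" for t
    proof -
      have "\<exists>s\<in>{t..\<beta>}. \<forall>y\<in>{t..\<beta>}. H y \<le> H s"
        using t ab by (intro continuous_attains_sup continuous_on_subset[OF H]) auto
      then obtain s where s: "s \<in> {t..\<beta>}" "\<And>y. y \<in> {t..\<beta>} \<Longrightarrow> H y \<le> H s"
        by blast
      show ?thesis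
      proof (cases "s = \<beta>")
        case True
        with s t show ?thesis by auto
      next
        case False
        then have "s \<in> \<Omega>"
          using s t C_sub ab by auto
        then obtain y where y: "y \<in> {s<..c}" "H s < H y"
          using \<Omega> by blast
        then have "\<beta> < y"
          using s by (metis atLeastAtMost_iff greaterThanAtMost_iff leD less_imp_le not_le order_trans)
        then have "H y \<le> H \<beta>"
          using \<Omega>[of \<beta>] ab y by force
        with y s(2)[of \<beta>] s(1) show ?thesis by auto
      qed
    qed
    have slope: "l * (\<beta> - t) \<le> F \<beta> - F t" if "t \<in> {\<alpha><..\<beta>}" for t
      using max[of t] that by (cases "t = \<beta>") (auto simp: H_def algebra_simps)
    have total: "F \<beta> - F \<alpha> \<le> l * (\<beta> - \<alpha>)"
    proof (cases "\<alpha> = x")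
      case True
      then show ?thesis using start ab by auto
    next
      case False
      then have "H \<beta> \<le> H \<alpha>"
        using \<Omega>[of \<alpha>] ab by force
      then show ?thesis by (simp add: H_def algebra_simps)
    qed
    have "emeasure S C \<le> (\<integral>\<^sup>+t\<in>{\<alpha>..\<beta>}. ennreal (f t) \<partial>lebesgue)"
      unfolding S_def ab
      by (subst emeasure_density) (auto intro!: nn_integral_mono simp: indicator_def)
    also have "\<dots> = ennreal (F \<beta> - F \<alpha>)"
      using ab by (intro primitive_on_nn_integral[OF F]) auto
    also have "\<dots> \<le> ennreal (l * (\<beta> - \<alpha>))"
      using total by (rule ennreal_leI)
    also have "\<dots> = ennreal l * ennreal (\<beta> - \<alpha>)"
      using l ab by (intro ennreal_mult) auto
    also have "\<dots> \<le> ennreal l * (4 * emeasure lebesgue ({\<alpha><..<\<beta>} \<inter> G))"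
      using ab slope by (intro mult_left_mono comp) auto
    also have "\<dots> = emeasure N C"
      unfolding ab by (subst N) (auto simp: ac_simps)
    finally show ?thesis .
  qed
  have S\<Omega>: "emeasure S \<Omega> \<le> emeasure N \<Omega>"
    by (rule emeasure_open_le_components[OF \<Omega>_open _ _ SN]) (simp_all add: S_def N_def)
  define E where "E = {t \<in> {x<..<c} - \<Omega>. l < f t}"
  have "E = {t \<in> space lebesgue. t \<in> {x<..<c} \<and> t \<notin> \<Omega> \<and> l < f t}"
    by (auto simp: E_def)
  also have "\<dots> \<in> sets lebesgue"
    by measurable
  finally have [measurable]: "E \<in> sets lebesgue" .
  have "E \<in> null_sets lebesgue"
  proof (rule null_set_slope[OF f F, where l = l])
    fix t y assume t: "t \<in> E" and y: "y \<in> {t..c}"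
    have "H y \<le> H t"
      using t y \<Omega>[of t] by (cases "y = t") (force simp: E_def)+
    then show "F y - F t \<le> l * (y - t)"
      by (simp add: H_def algebra_simps)
  next
    show "E \<in> sets lebesgue" by measurable
    show "E \<subseteq> {x<..<c}" "0 \<le> l" "\<And>t. t \<in> E \<Longrightarrow> l < f t"
      using l by (auto simp: E_def)
  qed
  moreover have "{x, c} \<in> null_sets lebesgue"
    by (intro finite_imp_null_set_lborel null_sets_completionI) auto
  ultimately have null: "E \<union> {x, c} \<in> null_sets lebesgue"
    by blast
  have "(\<integral>\<^sup>+t\<in>{t \<in> {x..c}. l < f t}. ennreal (f t) \<partial>lebesgue) \<le> (\<integral>\<^sup>+t\<in>\<Omega>. ennreal (f t) \<partial>lebesgue)"
  proof (rule nn_integral_mono_AE)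
    show "AE t in lebesgue. ennreal (f t) * indicator {t \<in> {x..c}. l < f t} t \<le> ennreal (f t) * indicator \<Omega> t"
      using AE_not_in[OF null]
      by eventually_elim (auto simp: E_def indicator_def)
  qed
  also have "\<dots> = emeasure S \<Omega>"
    unfolding S_def by (subst emeasure_density) auto
  also have "\<dots> \<le> 4 * ennreal l * emeasure lebesgue (\<Omega> \<inter> G)"
    using S\<Omega> by (subst (asm) N) auto
  also have "\<dots> \<le> 4 * ennreal l * emeasure lebesgue ({x..c} \<inter> G)"
    using \<Omega>_sub by (intro mult_left_mono emeasure_mono) auto
  finally show ?thesis .
qed

section \<open>The distribution inequality on a component\<close>

text \<open>The fraction \<open>\<eta>\<close> of a level \<open>l\<close> that the dual weight exceeds on a quarter of each component. It
  is chosen such that the dual weight equals \<open>\<eta> * l\<close> where \<open>w = 4 * (K * 2 powr (p - 1) * l powr (1 - p))\<close>.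
  The expression in parentheses, times the length of the component, bounds the mass of \<open>w\<close> in the
  left half of the component.\<close>

definition level_ratio :: "real \<Rightarrow> real \<Rightarrow> real" where
  "level_ratio p K = (2 powr (p + 1) * K) powr (- (1 / (p - 1)))"

text \<open>In the application \<open>D\<close> is the mass of the dual weight in the right half of the interval, so that
  hypothesis \<open>A\<close> is the \<open>A\<^sub>p\<^sup>+\<close> condition for the endpoints and the midpoint.\<close>

lemma measure_level_component:
  fixes v :: "real \<Rightarrow> real"
  assumes v [measurable]: "v \<in> borel_measurable lebesgue" and pos: "\<And>t. 0 < v t"
    and p: "1 < p" and K: "0 < K" and l: "0 < l" and ab: "\<alpha> < \<beta>"
    and D: "l * ((\<beta> - \<alpha>) / 2) \<le> D"
    and A: "(\<integral>\<^sup>+t\<in>{\<alpha>..(\<alpha> + \<beta>) / 2}. ennreal (v t) \<partial>lebesgue) * ennreal (D powr (p - 1))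
      \<le> ennreal (K * (\<beta> - \<alpha>) powr p)"
  shows "ennreal (\<beta> - \<alpha>)
    \<le> 4 * emeasure lebesgue ({\<alpha><..<\<beta>} \<inter> {t. level_ratio p K * l < v t powr (- (1 / (p - 1)))})"
proof -
  define h where "h = \<beta> - \<alpha>"
  define m where "m = (\<alpha> + \<beta>) / 2"
  define T where "T = 2 powr (p + 1) * K * l powr (1 - p)"
  have h: "0 < h" "m = \<alpha> + h / 2" "\<alpha> < m" "m < \<beta>"
    using ab by (auto simp: h_def m_def field_simps)
  have T: "0 < T"
    using K l by (simp add: T_def)
  define B where "B = {t \<in> {\<alpha>..m}. T \<le> v t}"
  define G where "G = {t \<in> {\<alpha><..<m}. v t < T}"
  have "B = {t \<in> space lebesgue. t \<in> {\<alpha>..m} \<and> T \<le> v t}"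
    by (auto simp: B_def)
  also have "\<dots> \<in> sets lebesgue" by measurable
  finally have Bm [measurable]: "B \<in> sets lebesgue" .
  have "G = {t \<in> space lebesgue. t \<in> {\<alpha><..<m} \<and> v t < T}"
    by (auto simp: G_def)
  also have "\<dots> \<in> sets lebesgue" by measurable
  finally have Gm [measurable]: "G \<in> sets lebesgue" .
  have "{t \<in> space lebesgue. level_ratio p K * l < v t powr (- (1 / (p - 1)))} \<in> sets lebesgue"
    by measurable
  then have Lm [measurable]: "{t. level_ratio p K * l < v t powr (- (1 / (p - 1)))} \<in> sets lebesgue"
    by simp
  have "emeasure lebesgue B \<le> emeasure lebesgue {\<alpha>..m}"
    by (intro emeasure_mono) (auto simp: B_def)
  also have "\<dots> = ennreal (h / 2)"
    using h by simp
  finally have Bfin: "emeasure lebesgue B \<noteq> top"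
    by (auto simp: top_unique)
  define \<beta>0 where "\<beta>0 = enn2real (emeasure lebesgue B)"
  have \<beta>0: "emeasure lebesgue B = ennreal \<beta>0" "0 \<le> \<beta>0"
    unfolding \<beta>0_def using ennreal_enn2real[OF Bfin[unfolded less_top]] by (simp_all only: enn2real_nonneg)
  have "ennreal T * ennreal \<beta>0 = (\<integral>\<^sup>+t. ennreal T * indicator B t \<partial>lebesgue)"
    using \<beta>0 by (simp add: nn_integral_cmult_indicator)
  also have "\<dots> \<le> (\<integral>\<^sup>+t\<in>{\<alpha>..m}. ennreal (v t) \<partial>lebesgue)"
    by (intro nn_integral_mono) (auto simp: indicator_def B_def ennreal_leI)
  finally have "ennreal T * ennreal \<beta>0 * ennreal (D powr (p - 1)) \<le> ennreal (K * h powr p)"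
    using A unfolding h_def[symmetric] m_def[symmetric] by (meson mult_right_mono order_trans zero_le)
  then have "ennreal (T * \<beta>0 * D powr (p - 1)) \<le> ennreal (K * h powr p)"
    using T \<beta>0 by (simp add: ennreal_mult)
  then have "T * \<beta>0 * D powr (p - 1) \<le> K * h powr p"
    using K by (simp add: ennreal_le_iff)
  moreover have "T * \<beta>0 * (l * (h / 2)) powr (p - 1) \<le> T * \<beta>0 * D powr (p - 1)"
    using T \<beta>0 D l h p unfolding h_def[symmetric]
    by (intro mult_left_mono powr_mono2) auto
  moreover have "T * \<beta>0 * (l * (h / 2)) powr (p - 1) = 4 * \<beta>0 * (K * h powr (p - 1))"
  proof -
    have 1: "l powr (1 - p) * l powr (p - 1) = 1"
      using l by (simp flip: powr_add)
    have 2: "2 powr (p + 1) * (1 / 2) powr (p - 1) = (4 :: real)"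
    proof -
      have "(1 / 2 :: real) powr (p - 1) = 2 powr (1 - p)"
        by (simp add: powr_divide powr_diff)
      then have "2 powr (p + 1) * (1 / 2) powr (p - 1) = (2::real) powr (p + 1 + (1 - p))"
        by (simp only: powr_add)
      then show ?thesis by simp
    qed
    have "(l * (h / 2)) powr (p - 1) = l powr (p - 1) * (h powr (p - 1) * (1 / 2) powr (p - 1))"
      using l h by (simp add: powr_mult flip: powr_mult)
    then have "T * \<beta>0 * (l * (h / 2)) powr (p - 1) =
        (2 powr (p + 1) * (1 / 2) powr (p - 1)) * (l powr (1 - p) * l powr (p - 1)) * \<beta>0 * (K * h powr (p - 1))"
      by (simp add: T_def mult_ac)
    then show ?thesis
      unfolding 1 2 by simp
  qed
  ultimately have "4 * \<beta>0 * (K * h powr (p - 1)) \<le> K * h powr p"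
    by linarith
  also have "K * h powr p = h * (K * h powr (p - 1))"
    using h powr_add[of h 1 "p - 1"] by simp
  finally have "4 * \<beta>0 \<le> h"
    using K h by simp
  have "ennreal (h / 2) = emeasure lebesgue {\<alpha><..<m}"
    using h by simp
  also have "\<dots> \<le> emeasure lebesgue (G \<union> B)"
  proof (rule emeasure_mono)
    show "{\<alpha><..<m} \<subseteq> G \<union> B"
      by (auto simp: G_def B_def)
  qed measurable
  also have "\<dots> \<le> emeasure lebesgue G + emeasure lebesgue B"
    by (intro emeasure_subadditive) auto
  also have "\<dots> \<le> emeasure lebesgue G + ennreal (h / 4)"
    using \<beta>0 \<open>4 * \<beta>0 \<le> h\<close> by (auto intro!: add_left_mono ennreal_leI)
  finally have "ennreal (h / 4) + ennreal (h / 4) \<le> emeasure lebesgue G + ennreal (h / 4)"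
    using h by (simp flip: ennreal_plus)
  then have "ennreal (h / 4) \<le> emeasure lebesgue G"
    by simp
  then have "4 * ennreal (h / 4) \<le> 4 * emeasure lebesgue G"
    by (rule mult_left_mono) simp
  then have "ennreal h \<le> 4 * emeasure lebesgue G"
    using h by (simp add: ennreal_mult'[symmetric] flip: ennreal_numeral)
  also have "emeasure lebesgue G \<le> emeasure lebesgue ({\<alpha><..<\<beta>} \<inter> {t. level_ratio p K * l < v t powr (- (1 / (p - 1)))})"
  proof (rule emeasure_mono)
    have "level_ratio p K * l = T powr (- (1 / (p - 1)))"
    proof -
      have "l = (l powr (1 - p)) powr (- (1 / (p - 1)))"
      proof -
        have "(1 - p) * (- (1 / (p - 1))) = 1"
          using p by (simp add: divide_simps)
        then show ?thesis
          using l by (simp only: powr_powr) simp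
      qed
      then show ?thesis
        using K unfolding level_ratio_def T_def by (simp add: powr_mult)
    qed
    moreover have "T powr (- (1 / (p - 1))) < v t powr (- (1 / (p - 1)))" if "v t < T" for t
      using that pos[of t] p by (intro powr_less_mono2_neg) auto
    ultimately show "G \<subseteq> {\<alpha><..<\<beta>} \<inter> {t. level_ratio p K * l < v t powr (- (1 / (p - 1)))}"
      using h by (auto simp: G_def)
  qed (rule sets.Int; measurable)
  finally show ?thesis
    unfolding h_def by (meson mult_left_mono order_trans zero_le)
qed

lemma ennreal_le_of_mult_le:
  assumes "W * ennreal x \<le> ennreal (y * x)" "0 < x" "0 \<le> y"
  shows "W \<le> ennreal y"
  using assms
  by (cases W) (auto simp: ennreal_top_mult ennreal_le_iff top_unique simp flip: ennreal_mult)

section \<open>The reverse Hoelder inequality\<close>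

text \<open>Let \<open>a l\<close> be the integral of \<open>f\<close> over \<open>{f > l}\<close>. In the hypothesis \<open>level\<close>, the part of the
  right-hand side where \<open>f > 8 * l\<close> is at most \<open>a (8 * l) / 2\<close>, and the part where
  \<open>\<eta> * l < f \<le> 8 * l\<close> is at most a multiple of \<open>a (\<eta> * l) - a (8 * l)\<close>. Hence
  \<open>a (M * k) \<le> \<rho> * a k\<close> with \<open>\<rho> < 1\<close>, so that \<open>a\<close> decays geometrically along the levels
  \<open>l0 * M ^ k\<close>. Summation over these levels bounds the higher power integral when
  \<open>M powr d * \<rho> < 1\<close>.\<close>

lemma reverse_holder_of_level_decay:
  fixes f :: "'a \<Rightarrow> real"
  assumes f [measurable]: "f \<in> borel_measurable N" and pos: "\<And>t. 0 \<le> f t"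
    and fin: "(\<integral>\<^sup>+t. ennreal (f t) \<partial>N) < \<infinity>"
    and \<eta>: "0 < \<eta>" "\<eta> \<le> 1" and l0: "0 < l0"
    and level: "\<And>l. l0 \<le> l \<Longrightarrow> (\<integral>\<^sup>+t\<in>{t. l < f t}. ennreal (f t) \<partial>N)
       \<le> 4 * ennreal l * emeasure N {t \<in> space N. \<eta> * l < f t}"
    and d: "0 < d" and M: "M = 8 / \<eta>" and \<rho>: "\<rho> = 8 / (8 + \<eta>)" and small: "M powr d * \<rho> < 1"
  shows "(\<integral>\<^sup>+t. ennreal (f t powr (1 + d)) \<partial>N)
    \<le> ennreal ((1 + M powr d / (1 - M powr d * \<rho>)) * l0 powr d) * (\<integral>\<^sup>+t. ennreal (f t) \<partial>N)"
proof -
  define a where "a = (\<lambda>l. enn2real (\<integral>\<^sup>+t\<in>{t. l < f t}. ennreal (f t) \<partial>N))"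
  define A where "A = enn2real (\<integral>\<^sup>+t. ennreal (f t) \<partial>N)"
  have level_meas [measurable]: "{t \<in> space N. l < f t} \<in> sets N" for l
    by measurable
  have A: "(\<integral>\<^sup>+t. ennreal (f t) \<partial>N) = ennreal A" "0 \<le> A"
    using fin by (simp_all add: A_def)
  have a_le: "(\<integral>\<^sup>+t\<in>{t. l < f t}. ennreal (f t) \<partial>N) \<le> (\<integral>\<^sup>+t. ennreal (f t) \<partial>N)" for l
    by (intro nn_integral_mono) (auto simp: indicator_def)
  have a: "(\<integral>\<^sup>+t\<in>{t. l < f t}. ennreal (f t) \<partial>N) = ennreal (a l)" "0 \<le> a l" for l
    using le_less_trans[OF a_le fin] by (simp_all add: a_def)
  have aA: "a l \<le> A" for l
    using a_le[of l] by (simp add: a A)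
  have M8: "8 \<le> M"
    using \<eta> M by (simp add: le_divide_eq)
  have \<rho>01: "0 < \<rho>" "\<rho> < 1"
    using \<eta> unfolding \<rho> by auto
  have decay: "a (M * k) \<le> \<rho> * a k" if k: "l0 \<le> k" for k
  proof -
    define l where "l = k / \<eta>"
    have "k \<le> l"
      using k l0 \<eta> by (simp add: l_def field_simps)
    then have l: "l0 \<le> l" "0 < l" using k l0 by auto
    have k_eq: "k = \<eta> * l" "M * k = 8 * l"
      using \<eta> M by (auto simp: l_def)
    have "ennreal (a l) \<le> 4 * ennreal l * emeasure N {t \<in> space N. k < f t}"
      using level[OF l(1)] unfolding a k_eq .
    also have "\<dots> = (\<integral>\<^sup>+t. 4 * ennreal l * indicator {t \<in> space N. k < f t} t \<partial>N)"
      by (subst nn_integral_cmult_indicator) auto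
    also have "\<dots> \<le> (\<integral>\<^sup>+t. ennreal (4 / \<eta>) * (ennreal (f t) * indicator {t. k < f t \<and> f t \<le> 8 * l} t)
        + ennreal (1 / 2) * (ennreal (f t) * indicator {t. 8 * l < f t} t) \<partial>N)"
    proof (intro nn_integral_mono)
      fix t assume "t \<in> space N"
      have "4 * ennreal l = ennreal (4 * l)"
        using l by (simp add: ennreal_mult)
      moreover have "ennreal (4 * l) \<le> ennreal (4 / \<eta>) * ennreal (f t)" if "k < f t"
      proof -
        have "4 * l \<le> 4 / \<eta> * f t"
          using that \<eta> k_eq by (simp add: field_simps)
        then show ?thesis
          using \<eta> by (subst ennreal_mult'[symmetric]) (auto intro: ennreal_leI)
      qed
      moreover have "ennreal (4 * l) \<le> ennreal (1 / 2) * ennreal (f t)" if "8 * l < f t"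
        using that by (subst ennreal_mult'[symmetric]) (auto intro: ennreal_leI)
      moreover have "k \<le> 8 * l"
        using \<open>k \<le> l\<close> l by simp
      ultimately show "4 * ennreal l * indicator {t \<in> space N. k < f t} t
        \<le> ennreal (4 / \<eta>) * (ennreal (f t) * indicator {t. k < f t \<and> f t \<le> 8 * l} t)
          + ennreal (1 / 2) * (ennreal (f t) * indicator {t. 8 * l < f t} t)"
        using \<open>t \<in> space N\<close> by (auto simp: indicator_def)
    qed
    also have "\<dots> = ennreal (4 / \<eta>) * (\<integral>\<^sup>+t\<in>{t. k < f t \<and> f t \<le> 8 * l}. ennreal (f t) \<partial>N) + ennreal (1 / 2) * ennreal (a (8 * l))"
      by (simp add: nn_integral_add nn_integral_cmult a)
    also have "(\<integral>\<^sup>+t\<in>{t. k < f t \<and> f t \<le> 8 * l}. ennreal (f t) \<partial>N) = ennreal (a k - a (8 * l))"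
    proof -
      have "ennreal (a k) = (\<integral>\<^sup>+t. ennreal (f t) * indicator {t. k < f t \<and> f t \<le> 8 * l} t
          + ennreal (f t) * indicator {t. 8 * l < f t} t \<partial>N)"
        unfolding a(1)[symmetric] using \<open>k \<le> l\<close> l by (intro nn_integral_cong) (auto simp: indicator_def)
      also have "\<dots> = (\<integral>\<^sup>+t\<in>{t. k < f t \<and> f t \<le> 8 * l}. ennreal (f t) \<partial>N) + ennreal (a (8 * l))"
        by (simp add: nn_integral_add a)
      finally have "(\<integral>\<^sup>+t\<in>{t. k < f t \<and> f t \<le> 8 * l}. ennreal (f t) \<partial>N) = ennreal (a k) - ennreal (a (8 * l))"
        by simp
      then show ?thesis
        using a by (simp add: ennreal_minus)
    qed
    finally have main: "ennreal (a l) \<le> ennreal (4 / \<eta>) * ennreal (a k - a (8 * l)) + ennreal (1 / 2) * ennreal (a (8 * l))" .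
    have mono: "a l' \<le> a l''" if "l'' \<le> l'" for l' l''
    proof -
      have "ennreal (a l') \<le> ennreal (a l'')"
        unfolding a(1)[symmetric] using that by (intro nn_integral_mono) (auto simp: indicator_def)
      then show ?thesis by (simp add: a)
    qed
    have "a (8 * l) \<le> a k" "a (8 * l) \<le> a l"
      using \<open>k \<le> l\<close> l by (auto intro!: mono)
    have "ennreal (4 / \<eta>) * ennreal (a k - a (8 * l)) = ennreal (4 / \<eta> * (a k - a (8 * l)))"
      using \<eta> \<open>a (8 * l) \<le> a k\<close> by (intro ennreal_mult[symmetric]) auto
    moreover have "ennreal (1 / 2) * ennreal (a (8 * l)) = ennreal (1 / 2 * a (8 * l))"
      using a by (intro ennreal_mult[symmetric]) auto
    moreover have nn: "0 \<le> 4 / \<eta> * (a k - a (8 * l))" "0 \<le> 1 / 2 * a (8 * l)"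
      using \<eta> a \<open>a (8 * l) \<le> a k\<close> by auto
    ultimately have "ennreal (a l) \<le> ennreal (4 / \<eta> * (a k - a (8 * l)) + 1 / 2 * a (8 * l))"
      using main by (simp only: ennreal_plus)
    then have "a l \<le> 4 / \<eta> * (a k - a (8 * l)) + 1 / 2 * a (8 * l)"
      using nn by (subst (asm) ennreal_le_iff) auto
    moreover have "1 / 2 * u \<le> X" if "u \<le> y" "y \<le> X + 1 / 2 * u" for u y X :: real
      using that by simp
    ultimately have "1 / 2 * a (8 * l) \<le> 4 / \<eta> * (a k - a (8 * l))"
      using \<open>a (8 * l) \<le> a l\<close> by blast
    then have "a (8 * l) * (8 + \<eta>) \<le> 8 * a k"
      using \<eta> by (simp add: field_simps)
    then show ?thesis
      unfolding k_eq(2) \<rho> using \<eta> by (simp add: field_simps)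
  qed
  have pow: "a (l0 * M ^ k) \<le> \<rho> ^ k * A" for k
  proof (induction k)
    case 0
    then show ?case using aA by simp
  next
    case (Suc k)
    have "l0 * 1 \<le> l0 * M ^ k"
      using l0 M8 by (intro mult_left_mono one_le_power) auto
    then have "a (M * (l0 * M ^ k)) \<le> \<rho> * a (l0 * M ^ k)"
      by (intro decay) simp
    also have "\<dots> \<le> \<rho> * (\<rho> ^ k * A)"
      using Suc \<rho>01 by (intro mult_left_mono) auto
    finally show ?case by (simp add: mult_ac)
  qed
  \<comment> \<open>If \<open>f t > l0\<close>, the summand with \<open>l0 * M ^ k < f t \<le> l0 * M ^ Suc k\<close> alone suffices.\<close>
  let ?q = "M powr d * \<rho>"
  have q: "0 \<le> ?q" using \<rho>01 by simp
  have pointwise: "ennreal (f t powr (1 + d)) \<le> ennreal (l0 powr d) * (ennreal (f t)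
      + (\<Sum>k. ennreal (M powr d * (M powr d) ^ k) * (ennreal (f t) * indicator {t. l0 * M ^ k < f t} t)))" for t
  proof (cases "f t \<le> l0")
    case True
    have "f t powr (1 + d) = f t powr d * f t"
      using pos[of t] by (cases "f t = 0") (auto simp: powr_add)
    also have "\<dots> \<le> l0 powr d * f t"
      using True pos[of t] d by (intro mult_right_mono powr_mono2) auto
    finally have "ennreal (f t powr (1 + d)) \<le> ennreal (l0 powr d) * ennreal (f t)"
      by (simp add: ennreal_leI pos flip: ennreal_mult)
    also have "\<dots> \<le> ennreal (l0 powr d) * (ennreal (f t)
      + (\<Sum>k. ennreal (M powr d * (M powr d) ^ k) * (ennreal (f t) * indicator {t. l0 * M ^ k < f t} t)))"
      by (intro mult_left_mono) auto
    finally show ?thesis .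
  next
    case False
    obtain k0 where "f t / l0 < M ^ k0"
      using real_arch_pow[of M] M8 by auto
    then have "f t \<le> l0 * M ^ k0"
      using l0 by (simp add: field_simps)
    then obtain n where n: "f t \<le> l0 * M ^ n" "\<And>i. i < n \<Longrightarrow> \<not> f t \<le> l0 * M ^ i"
      using exists_least_iff[of "\<lambda>k. f t \<le> l0 * M ^ k"] by blast
    obtain k where k: "n = Suc k"
      using n(1) False by (cases n) auto
    have fk: "l0 * M ^ k < f t" "f t \<le> l0 * M ^ Suc k"
      using n(1) n(2)[of k] k by auto
    have ft: "0 < f t"
      using False l0 by simp
    have Mpos: "0 < M" using M8 by simp
    have "f t powr d \<le> (l0 * M ^ Suc k) powr d"
      using fk pos[of t] d by (intro powr_mono2) auto
    also have "\<dots> = l0 powr d * (M powr d * (M powr d) ^ k)"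
      using l0 Mpos by (simp add: powr_mult powr_power mult_ac flip: powr_realpow)
        (simp add: powr_powr powr_add algebra_simps flip: powr_realpow)
    finally have "f t powr (1 + d) \<le> l0 powr d * (M powr d * (M powr d) ^ k) * f t"
      using ft by (simp add: powr_add)
    then have "ennreal (f t powr (1 + d)) \<le> ennreal (l0 powr d) *
        (ennreal (M powr d * (M powr d) ^ k) * ennreal (f t))"
      by (simp add: pos mult.assoc ennreal_leI flip: ennreal_mult)
    also have "ennreal (M powr d * (M powr d) ^ k) * ennreal (f t)
        = ennreal (M powr d * (M powr d) ^ k) * (ennreal (f t) * indicator {t. l0 * M ^ k < f t} t)"
      using fk by simp
    also have "\<dots> \<le> (\<Sum>k. ennreal (M powr d * (M powr d) ^ k) * (ennreal (f t) * indicator {t. l0 * M ^ k < f t} t))"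
      using sum_le_suminf[OF summableI, of "{k}" "\<lambda>k. ennreal (M powr d * (M powr d) ^ k) * (ennreal (f t) * indicator {t. l0 * M ^ k < f t} t)"]
      by simp
    also have "\<dots> \<le> ennreal (f t) + (\<Sum>k. ennreal (M powr d * (M powr d) ^ k) * (ennreal (f t) * indicator {t. l0 * M ^ k < f t} t))"
      by simp
    finally show ?thesis
      by (meson mult_left_mono order_trans zero_le)
  qed
  have "(\<integral>\<^sup>+t. ennreal (f t powr (1 + d)) \<partial>N)
     \<le> (\<integral>\<^sup>+t. ennreal (l0 powr d) * (ennreal (f t)
      + (\<Sum>k. ennreal (M powr d * (M powr d) ^ k) * (ennreal (f t) * indicator {t. l0 * M ^ k < f t} t))) \<partial>N)"
    by (intro nn_integral_mono pointwise)
  also have "\<dots> = ennreal (l0 powr d) * (ennreal A + (\<Sum>k. ennreal (M powr d * (M powr d) ^ k) * ennreal (a (l0 * M ^ k))))"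
    by (simp add: nn_integral_cmult nn_integral_add nn_integral_suminf a A)
  also have "(\<Sum>k. ennreal (M powr d * (M powr d) ^ k) * ennreal (a (l0 * M ^ k)))
      \<le> (\<Sum>k. ennreal (M powr d * A * ?q ^ k))"
  proof (intro suminf_le summableI)
    fix k
    have "M powr d * (M powr d) ^ k * a (l0 * M ^ k) \<le> M powr d * (M powr d) ^ k * (\<rho> ^ k * A)"
      using pow by (intro mult_left_mono) auto
    then show "ennreal (M powr d * (M powr d) ^ k) * ennreal (a (l0 * M ^ k)) \<le> ennreal (M powr d * A * ?q ^ k)"
      by (simp add: a ennreal_leI power_mult_distrib mult_ac flip: ennreal_mult)
  qed
  also have "(\<Sum>k. ennreal (M powr d * A * ?q ^ k)) = ennreal (M powr d * A * (1 / (1 - ?q)))"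
  proof (rule suminf_ennreal_eq)
    show "0 \<le> M powr d * A * ?q ^ k" for k
      using q A by simp
    show "(\<lambda>k. M powr d * A * ?q ^ k) sums (M powr d * A * (1 / (1 - ?q)))"
      using q small by (intro sums_mult geometric_sums) auto
  qed
  also have "ennreal (l0 powr d) * (ennreal A + ennreal (M powr d * A * (1 / (1 - ?q))))
      = ennreal ((1 + M powr d / (1 - ?q)) * l0 powr d) * ennreal A"
  proof -
    have "l0 powr d * (A + M powr d * A * (1 / (1 - ?q))) = (1 + M powr d / (1 - ?q)) * l0 powr d * A"
      by (simp add: algebra_simps divide_inverse)
    moreover have "0 \<le> M powr d * A * (1 / (1 - ?q))" "0 \<le> (1 + M powr d / (1 - ?q)) * l0 powr d"
      using A small by auto
    ultimately show ?thesis
      using A by (metis add_nonneg_nonneg ennreal_mult ennreal_plus powr_ge_zero)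
  qed
  finally show ?thesis
    unfolding A by (simp add: mult_left_mono add_left_mono)
qed

text \<open>The constants \<open>d\<close> and \<open>C\<close> depend only on \<open>p\<close> and \<open>K\<close>. The exponent \<open>- ((1 + d) / (p - 1))\<close> of \<open>v\<close> is
  \<open>1 + d\<close> times the exponent \<open>- (1 / (p - 1))\<close> of the dual weight, of which \<open>F\<close> is a primitive.\<close>

lemma reverse_holder_one_sided:
  assumes p: "1 < p" and K: "1 \<le> K"
  shows "\<exists>d>0. \<exists>C>0. \<forall>(v :: real \<Rightarrow> real) F x c l.
    v \<in> borel_measurable lebesgue \<longrightarrow> (\<forall>t. 0 < v t) \<longrightarrow>
    primitive_on {x..c} (\<lambda>t. v t powr (- (1 / (p - 1)))) F \<longrightarrow> x < c \<longrightarrow> 0 < l \<longrightarrow>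
    (\<forall>\<alpha> m \<beta>. x \<le> \<alpha> \<longrightarrow> \<alpha> < m \<longrightarrow> m < \<beta> \<longrightarrow> \<beta> \<le> c \<longrightarrow>
      (\<integral>\<^sup>+t\<in>{\<alpha>..m}. ennreal (v t) \<partial>lebesgue) * ennreal ((F \<beta> - F m) powr (p - 1))
        \<le> ennreal (K * (\<beta> - \<alpha>) powr p)) \<longrightarrow>
    (\<forall>y\<in>{x..c}. F y - F x \<le> l * (y - x)) \<longrightarrow>
    (\<integral>\<^sup>+t\<in>{x..c}. ennreal (v t powr (- ((1 + d) / (p - 1)))) \<partial>lebesgue)
      \<le> ennreal (C * l powr d * (F c - F x))"
proof -
  define \<eta> where "\<eta> = level_ratio p K"
  have "1 \<le> 2 powr (p + 1) * K"
    using p K ge_one_powr_ge_zero[of 2 "p + 1"] mult_mono[of 1 "2 powr (p + 1)" 1 K] by simp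
  then have \<eta>: "0 < \<eta>" "\<eta> \<le> 1"
    using p powr_mono2'[of "- (1 / (p - 1))" 1 "2 powr (p + 1) * K"]
    by (auto simp: \<eta>_def level_ratio_def)
  define M \<rho> where "M = 8 / \<eta>" and "\<rho> = 8 / (8 + \<eta>)"
  have M: "1 < M"
    using \<eta> by (simp add: M_def less_divide_eq)
  have \<rho>: "0 < \<rho>" "\<rho> < 1"
    using \<eta> by (auto simp: \<rho>_def)
  \<comment> \<open>This is \<open>M powr d = \<rho> powr (-1/2)\<close>, so \<open>M powr d * \<rho>\<close> is the square root of \<open>\<rho>\<close>.\<close>
  define d where "d = - ln \<rho> / (2 * ln M)"
  have d: "0 < d"
    using \<rho> M by (simp add: d_def divide_neg_pos)
  have small: "M powr d * \<rho> < 1"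
  proof -
    have "M powr d * \<rho> = exp (- ln \<rho> / 2) * exp (ln \<rho>)"
      using M \<rho> by (simp add: powr_def d_def)
    also have "\<dots> = exp (ln \<rho> / 2)"
      by (simp flip: exp_add)
    also have "\<dots> < 1"
      using \<rho> by simp
    finally show ?thesis .
  qed
  define C where "C = 1 + M powr d / (1 - M powr d * \<rho>)"
  have C: "0 < C"
    using small by (simp add: C_def add_pos_nonneg)
  show ?thesis
  proof (rule exI[of _ d], intro conjI d, rule exI[of _ C], intro conjI C allI impI)
    fix v F :: "real \<Rightarrow> real" and x c l :: real
    assume v [measurable]: "v \<in> borel_measurable lebesgue" and pos: "\<forall>t. 0 < v t"
      and F: "primitive_on {x..c} (\<lambda>t. v t powr (- (1 / (p - 1)))) F"
      and xc: "x < c" and l: "0 < l"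
      and A: "\<forall>\<alpha> m \<beta>. x \<le> \<alpha> \<longrightarrow> \<alpha> < m \<longrightarrow> m < \<beta> \<longrightarrow> \<beta> \<le> c \<longrightarrow>
        (\<integral>\<^sup>+t\<in>{\<alpha>..m}. ennreal (v t) \<partial>lebesgue) * ennreal ((F \<beta> - F m) powr (p - 1))
          \<le> ennreal (K * (\<beta> - \<alpha>) powr p)"
      and start: "\<forall>y\<in>{x..c}. F y - F x \<le> l * (y - x)"
    define \<sigma> where "\<sigma> = (\<lambda>t. v t powr (- (1 / (p - 1))))"
    have \<sigma> [measurable]: "\<sigma> \<in> borel_measurable lebesgue"
      unfolding \<sigma>_def by measurable
    define N where "N = lebesgue_on {x..c}"
    have N_int: "(\<integral>\<^sup>+t. ennreal (g t) \<partial>N) = (\<integral>\<^sup>+t\<in>{x..c}. ennreal (g t) \<partial>lebesgue)" for g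
      unfolding N_def by (subst nn_integral_restrict_space) (auto)
    have total: "(\<integral>\<^sup>+t. ennreal (\<sigma> t) \<partial>N) = ennreal (F c - F x)"
      unfolding N_int \<sigma>_def using primitive_on_nn_integral[OF F, of x c] xc by simp
    have "(\<integral>\<^sup>+t\<in>{x..c}. ennreal (v t powr (- ((1 + d) / (p - 1)))) \<partial>lebesgue)
        = (\<integral>\<^sup>+t. ennreal (\<sigma> t powr (1 + d)) \<partial>N)"
      unfolding N_int \<sigma>_def by (simp add: powr_powr)
    also have "\<dots> \<le> ennreal ((1 + M powr d / (1 - M powr d * \<rho>)) * l powr d) * (\<integral>\<^sup>+t. ennreal (\<sigma> t) \<partial>N)"
    proof (rule reverse_holder_of_level_decay[OF _ _ _ \<eta> l _ d M_def \<rho>_def small])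
      show "\<sigma> \<in> borel_measurable N"
        unfolding N_def by (intro measurable_restrict_space1 \<sigma>)
      show "0 \<le> \<sigma> t" for t by (simp add: \<sigma>_def)
      show "(\<integral>\<^sup>+t. ennreal (\<sigma> t) \<partial>N) < \<infinity>"
        by (simp add: total)
      fix k assume k: "l \<le> k"
      define G where "G = {t. \<eta> * k < \<sigma> t}"
      have "G = {t \<in> space lebesgue. \<eta> * k < \<sigma> t}" by (simp add: G_def)
      also have "\<dots> \<in> sets lebesgue" by measurable
      finally have Gm: "G \<in> sets lebesgue" .
      have "(\<integral>\<^sup>+t\<in>{t. k < \<sigma> t}. ennreal (\<sigma> t) \<partial>N)
          = (\<integral>\<^sup>+t\<in>{t \<in> {x..c}. k < \<sigma> t}. ennreal (\<sigma> t) \<partial>lebesgue)"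
        unfolding N_def
        by (subst nn_integral_restrict_space) (auto intro!: nn_integral_cong simp: indicator_def)
      also have "\<dots> \<le> 4 * ennreal k * emeasure lebesgue ({x..c} \<inter> G)"
      proof (rule rising_sun_level[OF \<sigma> F[folded \<sigma>_def] _ _ Gm])
        show "0 < k" using k l by simp
        show "F y - F x \<le> k * (y - x)" if "y \<in> {x..c}" for y
          using start that k mult_right_mono[of l k "y - x"] by force
        fix \<alpha> \<beta> assume ab: "x \<le> \<alpha>" "\<alpha> < \<beta>" "\<beta> \<le> c"
          and slope: "\<And>t. t \<in> {\<alpha><..\<beta>} \<Longrightarrow> k * (\<beta> - t) \<le> F \<beta> - F t"
        show "ennreal (\<beta> - \<alpha>) \<le> 4 * emeasure lebesgue ({\<alpha><..<\<beta>} \<inter> G)"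
          unfolding G_def \<sigma>_def \<eta>_def
        proof (rule measure_level_component[OF v _ p])
          show "k * ((\<beta> - \<alpha>) / 2) \<le> F \<beta> - F ((\<alpha> + \<beta>) / 2)"
            using slope[of "(\<alpha> + \<beta>) / 2"] ab by (simp add: field_simps)
          show "(\<integral>\<^sup>+t\<in>{\<alpha>..(\<alpha> + \<beta>) / 2}. ennreal (v t) \<partial>lebesgue)
              * ennreal ((F \<beta> - F ((\<alpha> + \<beta>) / 2)) powr (p - 1)) \<le> ennreal (K * (\<beta> - \<alpha>) powr p)"
            using A ab by simp
        qed (use pos K k l ab in auto)
      qed
      also have "emeasure lebesgue ({x..c} \<inter> G) = emeasure N {t \<in> space N. \<eta> * k < \<sigma> t}"
      proof -
        have "{t \<in> space N. \<eta> * k < \<sigma> t} = {x..c} \<inter> G"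
          by (auto simp: N_def G_def space_restrict_space)
        then show ?thesis
          unfolding N_def by (simp only:) (subst emeasure_restrict_space; auto)
      qed
      finally show "(\<integral>\<^sup>+t\<in>{t. k < \<sigma> t}. ennreal (\<sigma> t) \<partial>N)
          \<le> 4 * ennreal k * emeasure N {t \<in> space N. \<eta> * k < \<sigma> t}" .
    qed
    also have "\<dots> = ennreal (C * l powr d * (F c - F x))"
      unfolding total C_def[symmetric] using C primitive_on_mono[OF F, of x c] xc
      by (subst ennreal_mult[symmetric]) auto
    finally show "(\<integral>\<^sup>+t\<in>{x..c}. ennreal (v t powr (- ((1 + d) / (p - 1)))) \<partial>lebesgue)
      \<le> ennreal (C * l powr d * (F c - F x))" .
  qed
qed

section \<open>A weak type estimate for the one-sided maximal function\<close>

text \<open>If all averages of the dual weight over \<open>{t..\<beta>}\<close> are at least \<open>l\<close>, then the \<open>v\<close>-mass is at most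
  \<open>C * l powr (- p)\<close> times the mass of the dual weight. Choose \<open>m < z\<close> such that half of the
  dual mass \<open>D\<close> of \<open>{x..\<beta>}\<close> lies to the right of \<open>m\<close> and a quarter lies in \<open>{m..z}\<close>. Then \<open>A\<^sub>p\<^sup>+\<close>
  for \<open>(x, m, z)\<close>, with \<open>z - x \<le> D / l\<close>, controls \<open>{x..m}\<close>, and one continues with \<open>m\<close>, where the dual mass
  has been halved. This ends because \<open>m > b\<close> as soon as the dual mass is less than that of
  \<open>{b..\<beta>}\<close>, which is positive.\<close>

lemma weight_bound_by_halving:
  fixes v F :: "real \<Rightarrow> real"
  assumes [measurable]: "v \<in> borel_measurable lebesgue"
    and F: "continuous_on {a..\<beta>} F" "\<And>s t. a \<le> s \<Longrightarrow> s \<le> t \<Longrightarrow> t \<le> \<beta> \<Longrightarrow> F s \<le> F t"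
    and p: "1 < p" and K: "0 \<le> K" and l: "0 < l"
    and A: "\<And>x y z. a \<le> x \<Longrightarrow> x < y \<Longrightarrow> y < z \<Longrightarrow> z \<le> \<beta> \<Longrightarrow>
      (\<integral>\<^sup>+t\<in>{x..y}. ennreal (v t) \<partial>lebesgue) * ennreal ((F z - F y) powr (p - 1))
        \<le> ennreal (K * (z - x) powr p)"
    and slope: "\<And>t. t \<in> {a..\<beta>} \<Longrightarrow> l * (\<beta> - t) \<le> F \<beta> - F t"
    and b: "a \<le> b" "b < \<beta>"
  shows "(\<integral>\<^sup>+t\<in>{a..b}. ennreal (v t) \<partial>lebesgue)
    \<le> ennreal (2 * (4 powr (p - 1) * K * l powr (- p)) * (F \<beta> - F a))"
proof -
  define C where "C = 4 powr (p - 1) * K * l powr (- p)"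
  have C: "0 \<le> C" using K by (simp add: C_def)
  have b_pos: "0 < F \<beta> - F b"
  proof -
    have "0 < l * (\<beta> - b)" using b l by simp
    also have "\<dots> \<le> F \<beta> - F b" using b by (intro slope) auto
    finally show ?thesis .
  qed
  have halve: "\<exists>m. x < m \<and> m < \<beta> \<and> F \<beta> - F m = (F \<beta> - F x) / 2 \<and>
      (\<integral>\<^sup>+t\<in>{x..m}. ennreal (v t) \<partial>lebesgue) \<le> ennreal (C * (F \<beta> - F x))"
    if x: "x \<in> {a..b}" for x
  proof -
    define D where "D = F \<beta> - F x"
    have Dl: "l * (\<beta> - x) \<le> D"
      using slope[of x] x b by (simp add: D_def)
    have xb: "x < \<beta>" using x b by auto
    then have D: "0 < D"
      using l by (intro less_le_trans[OF _ Dl]) simp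
    have "\<exists>m\<ge>x. m \<le> \<beta> \<and> F m = F x + D / 2"
      using D xb x by (intro IVT' continuous_on_subset[OF F(1)]) (auto simp: D_def field_simps)
    then obtain m where m: "x \<le> m" "m \<le> \<beta>" "F m = F x + D / 2" by blast
    have m': "x < m" "m < \<beta>"
      using m D by (auto simp: D_def order_le_less field_simps)
    have "\<exists>z\<ge>m. z \<le> \<beta> \<and> F z = F x + 3 * D / 4"
      using D xb x m by (intro IVT' continuous_on_subset[OF F(1)]) (auto simp: D_def field_simps)
    then obtain z where z: "m \<le> z" "z \<le> \<beta>" "F z = F x + 3 * D / 4" by blast
    have "m < z"
      using z m D by (auto simp: order_le_less)
    define W where "W = (\<integral>\<^sup>+t\<in>{x..m}. ennreal (v t) \<partial>lebesgue)"
    have "W * ennreal ((D / 4) powr (p - 1)) \<le> ennreal (K * (z - x) powr p)"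
      using A[of x m z] x m' \<open>m < z\<close> z m unfolding W_def by simp
    also have "\<dots> \<le> ennreal (K * (D / l) powr p)"
    proof -
      have "z - x \<le> D / l"
        using z l order_trans[OF mult_left_mono[of "z - x" "\<beta> - x" l] Dl]
        by (simp add: le_divide_eq mult.commute)
      then show ?thesis
        using z m' \<open>m < z\<close> p K by (intro ennreal_leI mult_left_mono powr_mono2) auto
    qed
    also have "K * (D / l) powr p = C * D * (D / 4) powr (p - 1)"
    proof -
      have "D powr p = D * D powr (p - 1)"
        using D powr_add[of D 1 "p - 1"] by simp
      then show ?thesis
        using D l unfolding C_def by (simp add: powr_divide powr_minus field_simps)
    qed
    finally have "W \<le> ennreal (C * D)"
      using D C by (intro ennreal_le_of_mult_le[of W "(D / 4) powr (p - 1)"]) auto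
    then show ?thesis
      using m m' by (intro exI[of _ m]) (auto simp: D_def W_def field_simps)
  qed
  have bound: "(\<integral>\<^sup>+t\<in>{x..b}. ennreal (v t) \<partial>lebesgue) \<le> ennreal (2 * C * (F \<beta> - F x))"
    if "x \<in> {a..b}" "F \<beta> - F x \<le> 2 ^ n * (F \<beta> - F b)" for n x
    using that
  proof (induction n arbitrary: x)
    case (0 x)
    obtain m where m: "x < m" "m < \<beta>" "F \<beta> - F m = (F \<beta> - F x) / 2"
        "(\<integral>\<^sup>+t\<in>{x..m}. ennreal (v t) \<partial>lebesgue) \<le> ennreal (C * (F \<beta> - F x))"
      using halve 0 by blast
    have "F b < F m"
      using m 0 b_pos by simp
    then have "b < m"
      using F(2)[of m b] 0 m b by (cases "m \<le> b") auto
    then have "(\<integral>\<^sup>+t\<in>{x..b}. ennreal (v t) \<partial>lebesgue) \<le> (\<integral>\<^sup>+t\<in>{x..m}. ennreal (v t) \<partial>lebesgue)"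
      by (intro nn_integral_mono) (auto simp: indicator_def)
    also have "\<dots> \<le> ennreal (C * (F \<beta> - F x))"
      by (rule m)
    also have "\<dots> \<le> ennreal (2 * C * (F \<beta> - F x))"
      using C F(2)[of x \<beta>] 0 b by (intro ennreal_leI mult_right_mono) auto
    finally show ?case .
  next
    case (Suc n x)
    obtain m where m: "x < m" "m < \<beta>" "F \<beta> - F m = (F \<beta> - F x) / 2"
        "(\<integral>\<^sup>+t\<in>{x..m}. ennreal (v t) \<partial>lebesgue) \<le> ennreal (C * (F \<beta> - F x))"
      using halve Suc by blast
    have Fx: "0 \<le> F \<beta> - F x"
      using F(2)[of x \<beta>] Suc b by simp
    have rest: "(\<integral>\<^sup>+t\<in>{m..b}. ennreal (v t) \<partial>lebesgue) \<le> ennreal (C * (F \<beta> - F x))"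
    proof (cases "m \<le> b")
      case True
      then have "(\<integral>\<^sup>+t\<in>{m..b}. ennreal (v t) \<partial>lebesgue) \<le> ennreal (2 * C * (F \<beta> - F m))"
        using m Suc.prems by (intro Suc.IH) auto
      then show ?thesis
        using m(3) by simp
    qed simp
    have "(\<integral>\<^sup>+t\<in>{x..b}. ennreal (v t) \<partial>lebesgue)
        \<le> (\<integral>\<^sup>+t. ennreal (v t) * indicator {x..m} t + ennreal (v t) * indicator {m..b} t \<partial>lebesgue)"
      by (intro nn_integral_mono) (auto simp: indicator_def)
    also have "\<dots> = (\<integral>\<^sup>+t\<in>{x..m}. ennreal (v t) \<partial>lebesgue) + (\<integral>\<^sup>+t\<in>{m..b}. ennreal (v t) \<partial>lebesgue)"
      by (rule nn_integral_add) measurable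
    also have "\<dots> \<le> ennreal (C * (F \<beta> - F x)) + ennreal (C * (F \<beta> - F x))"
      using m(4) rest by (rule add_mono)
    also have "\<dots> = ennreal (2 * C * (F \<beta> - F x))"
      using C Fx by (simp flip: ennreal_plus)
    finally show ?case .
  qed
  obtain n where "(F \<beta> - F a) / (F \<beta> - F b) < 2 ^ n"
    using real_arch_pow[of 2 "(F \<beta> - F a) / (F \<beta> - F b)"] by auto
  then have "F \<beta> - F a \<le> 2 ^ n * (F \<beta> - F b)"
    using b_pos by (simp add: field_simps)
  then show ?thesis
    using bound[of a n] b unfolding C_def by simp
qed

text \<open>If the conclusion fails, then every point of \<open>{a..b}\<close> is the left end of an interval in \<open>{a..c}\<close>
  over which the average of the dual weight is greater than \<open>l\<close>.
  Then \<open>F t - l * t\<close> attains its maximum over \<open>{a..c}\<close> at some \<open>\<beta> > b\<close>, so a single interval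
  \<open>{a..\<beta>}\<close> satisfies the hypotheses of the preceding lemma, without any covering argument.\<close>

lemma exists_slope_start:
  fixes v F :: "real \<Rightarrow> real"
  assumes v: "v \<in> borel_measurable lebesgue"
    and F: "continuous_on {a..c} F" "\<And>s t. a \<le> s \<Longrightarrow> s \<le> t \<Longrightarrow> t \<le> c \<Longrightarrow> F s \<le> F t"
    and p: "1 < p" and K: "0 \<le> K" and l: "0 < l"
    and A: "\<And>x y z. a \<le> x \<Longrightarrow> x < y \<Longrightarrow> y < z \<Longrightarrow> z \<le> c \<Longrightarrow>
      (\<integral>\<^sup>+t\<in>{x..y}. ennreal (v t) \<partial>lebesgue) * ennreal ((F z - F y) powr (p - 1))
        \<le> ennreal (K * (z - x) powr p)"
    and b: "a \<le> b" "b < c"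
    and large: "ennreal (2 * (4 powr (p - 1) * K * l powr (- p)) * (F c - F a))
      < (\<integral>\<^sup>+t\<in>{a..b}. ennreal (v t) \<partial>lebesgue)"
  shows "\<exists>x\<in>{a..b}. \<forall>y\<in>{x..c}. F y - F x \<le> l * (y - x)"
proof (rule ccontr)
  assume contra: "\<not> ?thesis"
  define H where "H = (\<lambda>t. F t - l * t)"
  have "\<exists>\<beta>\<in>{a..c}. \<forall>t\<in>{a..c}. H t \<le> H \<beta>"
    using b by (intro continuous_attains_sup) (auto simp: H_def intro!: continuous_intros F)
  then obtain \<beta> where \<beta>: "\<beta> \<in> {a..c}" "\<And>t. t \<in> {a..c} \<Longrightarrow> H t \<le> H \<beta>"
    by blast
  have "b < \<beta>"
  proof (rule ccontr)
    assume "\<not> b < \<beta>"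
    then have "\<beta> \<in> {a..b}" using \<beta> by simp
    then obtain y where "y \<in> {\<beta>..c}" "l * (y - \<beta>) < F y - F \<beta>"
      using contra by (meson not_le)
    then show False
      using \<beta>(1) \<beta>(2)[of y] by (simp add: H_def algebra_simps)
  qed
  have "(\<integral>\<^sup>+t\<in>{a..b}. ennreal (v t) \<partial>lebesgue)
      \<le> ennreal (2 * (4 powr (p - 1) * K * l powr (- p)) * (F \<beta> - F a))"
  proof (rule weight_bound_by_halving[OF v _ _ p K l _ _ b(1) \<open>b < \<beta>\<close>])
    show "continuous_on {a..\<beta>} F"
      by (rule continuous_on_subset[OF F(1)]) (use \<beta> in auto)
    show "l * (\<beta> - t) \<le> F \<beta> - F t" if "t \<in> {a..\<beta>}" for t
      using \<beta>(2)[of t] \<beta>(1) that by (simp add: H_def algebra_simps)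
  qed (use \<beta>(1) in \<open>auto intro: F(2) A\<close>)
  also have "\<dots> \<le> ennreal (2 * (4 powr (p - 1) * K * l powr (- p)) * (F c - F a))"
    using K F(2)[of \<beta> c] \<beta>(1) by (intro ennreal_leI mult_left_mono) auto
  finally show False
    using large by simp
qed

section \<open>Self-improvement of the one-sided condition\<close>

lemma ennreal_powr_le:
  assumes "x \<le> ennreal r" "0 \<le> r" "0 \<le> e"
  shows "ennreal_powr x e \<le> ennreal (r powr e)"
  using assms
  by (cases x) (auto simp: ennreal_powr_def top_unique intro!: ennreal_leI powr_mono2)

lemma conjugate_exponent_minus_one:
  "1 < q \<Longrightarrow> 1 - conjugate_exponent q = - (1 / (q - 1))"
  by (simp add: conjugate_exponent_def field_simps)

text \<open>The condition \<open>A\<^sub>q\<^sup>+\<close> on \<open>J\<close> with constant \<open>K\<close>.\<close>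

definition Ap_bound :: "real \<Rightarrow> real set \<Rightarrow> (real \<Rightarrow> real) \<Rightarrow> real \<Rightarrow> bool" where
  "Ap_bound q J v K \<longleftrightarrow> (\<forall>a\<in>J. \<forall>b\<in>J. \<forall>c\<in>J. a < b \<longrightarrow> b < c \<longrightarrow>
     ennreal (1 / (c - a) powr q)
       * (\<integral>\<^sup>+t\<in>{a..b}. ennreal (v t) \<partial>lebesgue)
       * ennreal_powr (\<integral>\<^sup>+t\<in>{b..c}. ennreal (v t powr (1 - conjugate_exponent q)) \<partial>lebesgue) (q - 1)
     \<le> ennreal K)"

text \<open>Since \<open>v\<close> is positive, both integrals are positive, and hence the bound for their product makes
  both of them finite.\<close>

lemma Ap_boundD:
  assumes bd: "Ap_bound q J v K" and v [measurable]: "v \<in> borel_measurable lebesgue"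
    and pos: "\<And>t. 0 < v t" and q: "1 < q" and K: "0 \<le> K"
    and abc: "a \<in> J" "b \<in> J" "c \<in> J" "a < b" "b < c"
  obtains s where "(\<integral>\<^sup>+t\<in>{b..c}. ennreal (v t powr (- (1 / (q - 1)))) \<partial>lebesgue) = ennreal s" "0 < s"
    "(\<integral>\<^sup>+t\<in>{a..b}. ennreal (v t) \<partial>lebesgue) * ennreal (s powr (q - 1)) \<le> ennreal (K * (c - a) powr q)"
    "(\<integral>\<^sup>+t\<in>{a..b}. ennreal (v t) \<partial>lebesgue) < \<infinity>"
proof -
  define W where "W = (\<integral>\<^sup>+t\<in>{a..b}. ennreal (v t) \<partial>lebesgue)"
  define S where "S = (\<integral>\<^sup>+t\<in>{b..c}. ennreal (v t powr (- (1 / (q - 1)))) \<partial>lebesgue)"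
  have W: "0 < W"
    unfolding W_def by (rule nn_integral_pos_interval) (use pos abc in auto)
  have S: "0 < S"
    unfolding S_def by (rule nn_integral_pos_interval) (use abc in \<open>auto simp: less_imp_neq[OF pos, symmetric]\<close>)
  define k where "k = 1 / (c - a) powr q"
  have k: "0 < k" using abc by (simp add: k_def)
  have "ennreal k * W * ennreal_powr S (q - 1) \<le> ennreal K"
    using bd abc unfolding Ap_bound_def conjugate_exponent_minus_one[OF q] W_def S_def k_def by blast
  then have main: "ennreal k * (W * ennreal_powr S (q - 1)) \<le> ennreal K"
    by (simp add: mult.assoc)
  have "S \<noteq> top"
  proof
    assume "S = top"
    then have "ennreal k * (W * ennreal_powr S (q - 1)) = top"
      using W k by (simp add: ennreal_powr_def ennreal_mult_eq_top_iff ennreal_eq_0_iff)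
    with main show False by (simp add: top_unique)
  qed
  then obtain s where s: "S = ennreal s" "0 \<le> s" by (cases S) auto
  then have s0: "0 < s" using S by simp
  have "ennreal k * (W * ennreal (s powr (q - 1))) \<le> ennreal K"
    using main s by (simp add: ennreal_powr_def)
  then have fin: "ennreal k * (W * ennreal (s powr (q - 1))) \<noteq> top"
    using ennreal_neq_top[of K] by (metis top_unique)
  have "W \<noteq> top"
  proof
    assume "W = top"
    then have "ennreal k * (W * ennreal (s powr (q - 1))) = top"
      using k s0 by (simp add: ennreal_mult_eq_top_iff ennreal_eq_0_iff)
    with fin show False by contradiction
  qed
  have "K * (c - a) powr q * k = K"
    using abc by (simp add: k_def)
  moreover have "W * ennreal (s powr (q - 1)) * ennreal k \<le> ennreal K"
    using \<open>ennreal k * (W * ennreal (s powr (q - 1))) \<le> ennreal K\<close> by (simp only: mult.commute)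
  ultimately have "W * ennreal (s powr (q - 1)) * ennreal k \<le> ennreal (K * (c - a) powr q * k)"
    by (simp only:)
  then have "W * ennreal (s powr (q - 1)) \<le> ennreal (K * (c - a) powr q)"
    using k by (rule ennreal_le_of_mult_le) (use K in simp)
  with \<open>W \<noteq> top\<close> s s0 show thesis
    by (intro that[of s]) (auto simp: W_def S_def less_top)
qed

text \<open>In the application \<open>w\<close> and \<open>s\<close> are masses of the weight and of its dual, \<open>h\<close> is the length of
  the interval, and \<open>(B * s / w) powr (1 / p)\<close> is the level \<open>l\<close> in the reverse Hoelder inequality. The choice
  of \<open>q\<close> makes the exponents of \<open>w\<close> and \<open>s\<close> proportional to \<open>1\<close> and \<open>p - 1\<close>, with factor
  \<open>q / p\<close>.\<close>

lemma exponent_bookkeeping: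
  fixes p q d C B K w s h :: real
  assumes p: "1 < p" and d: "0 < d" and q: "q = 1 + (p - 1) / (1 + d)"
    and pos: "0 < C" "0 < B" "0 < K" "0 < w" "0 < s" "0 < h"
    and ws: "w * s powr (p - 1) \<le> K * h powr p"
  shows "w * (C * ((B * s / w) powr (1 / p)) powr d * s) powr (q - 1)
    \<le> C powr (q - 1) * B powr (d * (q - 1) / p) * K powr (q / p) * h powr q"
proof -
  have pq: "p - 1 = (q - 1) * (1 + d)"
    using q d by simp
  have q0: "1 < q"
    using p d q by simp
  have e1: "1 - d * (q - 1) / p = q / p"
    using pq p by (simp add: field_simps)
  have e2: "(q - 1) + d * (q - 1) / p = (p - 1) * (q / p)"
  proof -
    have "p = q + d * (q - 1)" using pq by (simp add: algebra_simps)
    then have "(q - 1) * p + d * (q - 1) = (p - 1) * q"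
      by (simp only:) (simp add: algebra_simps)
    then show ?thesis using p by (simp add: field_simps)
  qed
  define e where "e = d * (q - 1) / p"
  have "w * (C * ((B * s / w) powr (1 / p)) powr d * s) powr (q - 1)
      = w * (C powr (q - 1) * (B * s / w) powr e * s powr (q - 1))"
    using pos p by (simp add: powr_mult powr_powr e_def)
  also have "(B * s / w) powr e = B powr e * s powr e * w powr (- e)"
    using pos by (simp add: powr_mult powr_divide powr_minus divide_inverse inverse_powr)
  also have "w * (C powr (q - 1) * (B powr e * s powr e * w powr (- e)) * s powr (q - 1))
      = C powr (q - 1) * B powr e * (w powr (1 - e) * s powr ((q - 1) + e))"
    using pos by (simp add: powr_add powr_diff powr_minus field_simps)
  also have "w powr (1 - e) * s powr ((q - 1) + e) = (w * s powr (p - 1)) powr (q / p)"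
    using pos unfolding e_def e1 e2 by (simp add: powr_mult powr_powr)
  also have "C powr (q - 1) * B powr e * (w * s powr (p - 1)) powr (q / p)
      \<le> C powr (q - 1) * B powr e * (K * h powr p) powr (q / p)"
    using ws pos p q0 by (intro mult_left_mono powr_mono2) auto
  also have "(K * h powr p) powr (q / p) = K powr (q / p) * h powr q"
    using pos p by (simp add: powr_mult powr_powr)
  finally show ?thesis
    by (simp add: e_def mult.assoc)
qed

lemma Ap_bound_self_improvement:
  fixes v :: "real \<Rightarrow> real"
  assumes bd: "Ap_bound p J v K" and v [measurable]: "v \<in> borel_measurable lebesgue"
    and pos: "\<And>t. 0 < v t" and p: "1 < p" and K: "1 \<le> K" and J: "is_interval J"
  shows "\<exists>q K'. 1 < q \<and> q < p \<and> Ap_bound q J v K'"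
proof -
  obtain d C where d: "0 < d" and C: "0 < C"
    and RH: "\<forall>(v :: real \<Rightarrow> real) F x c l.
    v \<in> borel_measurable lebesgue \<longrightarrow> (\<forall>t. 0 < v t) \<longrightarrow>
    primitive_on {x..c} (\<lambda>t. v t powr (- (1 / (p - 1)))) F \<longrightarrow> x < c \<longrightarrow> 0 < l \<longrightarrow>
    (\<forall>\<alpha> m \<beta>. x \<le> \<alpha> \<longrightarrow> \<alpha> < m \<longrightarrow> m < \<beta> \<longrightarrow> \<beta> \<le> c \<longrightarrow>
      (\<integral>\<^sup>+t\<in>{\<alpha>..m}. ennreal (v t) \<partial>lebesgue) * ennreal ((F \<beta> - F m) powr (p - 1))
        \<le> ennreal (K * (\<beta> - \<alpha>) powr p)) \<longrightarrow>
    (\<forall>y\<in>{x..c}. F y - F x \<le> l * (y - x)) \<longrightarrow>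
    (\<integral>\<^sup>+t\<in>{x..c}. ennreal (v t powr (- ((1 + d) / (p - 1)))) \<partial>lebesgue)
      \<le> ennreal (C * l powr d * (F c - F x))"
    using reverse_holder_one_sided[OF p K] by (elim exE conjE) (rule that; assumption)
  define q where "q = 1 + (p - 1) / (1 + d)"
  have q: "1 < q" "q < p"
    using p d by (auto simp: q_def field_simps)
  have q_exp: "1 - conjugate_exponent q = - ((1 + d) / (p - 1))"
    unfolding conjugate_exponent_minus_one[OF q(1)] using p d by (simp add: q_def)
  \<comment> \<open>With \<open>l = (B * s / w) powr (1 / p)\<close> the weak type bound becomes \<open>w / 6\<close>, which is less than the
    mass \<open>w / 3\<close> of the middle piece.\<close>
  define B where "B = 12 * 4 powr (p - 1) * K"
  have B: "0 < B" using K by (simp add: B_def)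
  define K' where "K' = C powr (q - 1) * B powr (d * (q - 1) / p) * (3 * K) powr (q / p)"
  have "Ap_bound q J v K'"
    unfolding Ap_bound_def
  proof (intro ballI impI)
    fix a b c assume abc: "a \<in> J" "b \<in> J" "c \<in> J" and ab: "a < b" and bc: "b < c"
    have inJ: "t \<in> J" if "a \<le> t" "t \<le> c" for t
      using J abc(1,3) that by (metis is_interval_1)
    have fin_W: "(\<integral>\<^sup>+t\<in>{a..b}. ennreal (v t) \<partial>lebesgue) < \<infinity>"
      using Ap_boundD[OF bd v pos p _ abc ab bc] K by (metis order_trans zero_le_one)
    obtain G where G: "primitive_on {a..b} v G"
      using exists_primitive_on[OF v _ fin_W] pos less_imp_le by blast
    define w where "w = G b - G a"
    have w: "0 < w"
      using primitive_on_strict_mono[OF G v] pos ab by (simp add: w_def)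
    have W: "(\<integral>\<^sup>+t\<in>{a..b}. ennreal (v t) \<partial>lebesgue) = ennreal w"
      using primitive_on_nn_integral[OF G, of a b] ab by (simp add: w_def)
    have "continuous_on {a..b} G"
      using G by (simp add: primitive_on_def)
    then have "\<exists>b1\<ge>a. b1 \<le> b \<and> G b1 = G a + w / 3" "\<exists>b2\<ge>a. b2 \<le> b \<and> G b2 = G a + 2 * w / 3"
      using w ab by (intro IVT'; simp add: w_def field_simps)+
    then obtain b1 b2 where b1: "a \<le> b1" "b1 \<le> b" "G b1 = G a + w / 3"
      and b2: "a \<le> b2" "b2 \<le> b" "G b2 = G a + 2 * w / 3" by blast
    have "b1 \<noteq> a" "b2 \<noteq> b"
      using b1 b2 w by (auto simp: w_def field_simps)
    then have b1': "a < b1" and b2': "b2 < b"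
      using b1 b2 by auto
    have b12: "b1 \<le> b2"
      using primitive_on_mono[OF G, of b2 b1] b1 b2 w by (cases "b1 \<le> b2") auto
    have b1c: "b1 < c" using b1 bc by simp
    obtain s where s: "(\<integral>\<^sup>+t\<in>{b1..c}. ennreal (v t powr (- (1 / (p - 1)))) \<partial>lebesgue) = ennreal s" "0 < s"
      "(\<integral>\<^sup>+t\<in>{a..b1}. ennreal (v t) \<partial>lebesgue) * ennreal (s powr (p - 1)) \<le> ennreal (K * (c - a) powr p)"
      using Ap_boundD[OF bd v pos p _ abc(1) inJ[of b1] abc(3) b1' b1c] K b1 bc by force
    have "\<exists>F. primitive_on {b1..c} (\<lambda>t. v t powr (- (1 / (p - 1)))) F"
      by (rule exists_primitive_on) (use s in auto)
    then obtain F where F: "primitive_on {b1..c} (\<lambda>t. v t powr (- (1 / (p - 1)))) F" by blast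
    have Fc: "F c - F b1 = s"
      using primitive_on_nn_integral[OF F, of b1 c] s b1c primitive_on_mono[OF F, of b1 c]
      by (simp add: ennreal_inj)
    have ws: "w / 3 * s powr (p - 1) \<le> K * (c - a) powr p"
    proof -
      have "(\<integral>\<^sup>+t\<in>{a..b1}. ennreal (v t) \<partial>lebesgue) = ennreal (w / 3)"
        using primitive_on_nn_integral[OF G, of a b1] b1 ab by simp
      then have "ennreal (w / 3 * s powr (p - 1)) \<le> ennreal (K * (c - a) powr p)"
        using s(3) w by (simp only: ennreal_mult[of "w / 3" "s powr (p - 1)"] powr_ge_zero)
      then show ?thesis
        using K by (simp add: ennreal_le_iff)
    qed
    have A: "(\<integral>\<^sup>+t\<in>{x..y}. ennreal (v t) \<partial>lebesgue) * ennreal ((F z - F y) powr (p - 1))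
        \<le> ennreal (K * (z - x) powr p)" if xyz: "b1 \<le> x" "x < y" "y < z" "z \<le> c" for x y z
    proof -
      obtain r where r: "(\<integral>\<^sup>+t\<in>{y..z}. ennreal (v t powr (- (1 / (p - 1)))) \<partial>lebesgue) = ennreal r" "0 < r"
        "(\<integral>\<^sup>+t\<in>{x..y}. ennreal (v t) \<partial>lebesgue) * ennreal (r powr (p - 1)) \<le> ennreal (K * (z - x) powr p)"
        using Ap_boundD[OF bd v pos p _ inJ[of x] inJ[of y] inJ[of z] xyz(2,3)] K b1 xyz by force
      moreover have "F z - F y = r"
        using primitive_on_nn_integral[OF F, of y z] r xyz primitive_on_mono[OF F, of y z]
        by (simp add: ennreal_inj)
      ultimately show ?thesis by simp
    qed
    define l where "l = (B * s / w) powr (1 / p)"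
    have l: "0 < l" using B s w by (simp add: l_def)
    have "\<exists>x\<in>{b1..b2}. \<forall>y\<in>{x..c}. F y - F x \<le> l * (y - x)"
    proof (rule exists_slope_start[OF v _ _ p _ l A])
      show "continuous_on {b1..c} F"
        using F by (simp add: primitive_on_def)
      show "F x \<le> F y" if "b1 \<le> x" "x \<le> y" "y \<le> c" for x y
        using primitive_on_mono[OF F, of x y] that by simp
      have "l powr (- p) = w / (B * s)"
        using B s w p by (simp add: l_def powr_powr powr_minus)
      then have "2 * (4 powr (p - 1) * K * l powr (- p)) * (F c - F b1) = w / 6"
        unfolding Fc using s K w by (simp add: B_def)
      also have "\<dots> < w / 3" using w by simp
      finally have "2 * (4 powr (p - 1) * K * l powr (- p)) * (F c - F b1) < w / 3" .
      then have "ennreal (2 * (4 powr (p - 1) * K * l powr (- p)) * (F c - F b1)) < ennreal (w / 3)"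
        by (rule ennreal_lessI[rotated]) (use w in simp)
      also have "ennreal (w / 3) = (\<integral>\<^sup>+t\<in>{b1..b2}. ennreal (v t) \<partial>lebesgue)"
        using primitive_on_nn_integral[OF G, of b1 b2] b1 b2 b12 by (simp add: field_simps)
      finally show "ennreal (2 * (4 powr (p - 1) * K * l powr (- p)) * (F c - F b1))
          < (\<integral>\<^sup>+t\<in>{b1..b2}. ennreal (v t) \<partial>lebesgue)" .
    qed (use K b12 b2' bc in auto)
    then obtain x where x: "x \<in> {b1..b2}" and start: "\<forall>y\<in>{x..c}. F y - F x \<le> l * (y - x)"
      by blast
    have xc: "x < c" using x b2' bc by simp
    have "(\<integral>\<^sup>+t\<in>{b..c}. ennreal (v t powr (1 - conjugate_exponent q)) \<partial>lebesgue)
        \<le> (\<integral>\<^sup>+t\<in>{x..c}. ennreal (v t powr (- ((1 + d) / (p - 1)))) \<partial>lebesgue)"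
      unfolding q_exp using x b2' by (intro nn_integral_mono) (auto simp: indicator_def)
    also have "\<dots> \<le> ennreal (C * l powr d * (F c - F x))"
      by (rule RH[rule_format, OF v _ primitive_on_subset[OF F] xc l])
        (use pos x A start in auto)
    also have "\<dots> \<le> ennreal (C * l powr d * s)"
      unfolding Fc[symmetric] using primitive_on_mono[OF F, of b1 x] x xc C
      by (intro ennreal_leI mult_left_mono) auto
    finally have T: "ennreal_powr (\<integral>\<^sup>+t\<in>{b..c}. ennreal (v t powr (1 - conjugate_exponent q)) \<partial>lebesgue) (q - 1)
        \<le> ennreal ((C * l powr d * s) powr (q - 1))"
      using C s q by (intro ennreal_powr_le) auto
    have final: "w * (C * l powr d * s) powr (q - 1) \<le> K' * (c - a) powr q"
      unfolding l_def K'_def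
      by (rule exponent_bookkeeping[OF p d q_def C B]) (use K w s ws ab bc in auto)
    have "ennreal (1 / (c - a) powr q)
       * (\<integral>\<^sup>+t\<in>{a..b}. ennreal (v t) \<partial>lebesgue)
       * ennreal_powr (\<integral>\<^sup>+t\<in>{b..c}. ennreal (v t powr (1 - conjugate_exponent q)) \<partial>lebesgue) (q - 1)
     \<le> ennreal (1 / (c - a) powr q) * ennreal w * ennreal ((C * l powr d * s) powr (q - 1))"
      unfolding W using T by (intro mult_left_mono) auto
    also have "\<dots> = ennreal (1 / (c - a) powr q * (w * (C * l powr d * s) powr (q - 1)))"
    proof -
      have "ennreal (w * (C * l powr d * s) powr (q - 1)) = ennreal w * ennreal ((C * l powr d * s) powr (q - 1))"
        using w by (intro ennreal_mult) auto
      moreover have "ennreal (1 / (c - a) powr q * (w * (C * l powr d * s) powr (q - 1)))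
          = ennreal (1 / (c - a) powr q) * ennreal (w * (C * l powr d * s) powr (q - 1))"
        using w by (intro ennreal_mult) auto
      ultimately show ?thesis
        by (simp only: mult.assoc)
    qed
    also have "\<dots> \<le> ennreal (1 / (c - a) powr q * (K' * (c - a) powr q))"
      using final by (intro ennreal_leI mult_left_mono) auto
    also have "\<dots> = ennreal K'"
      using ab bc by simp
    finally show "ennreal (1 / (c - a) powr q)
       * (\<integral>\<^sup>+t\<in>{a..b}. ennreal (v t) \<partial>lebesgue)
       * ennreal_powr (\<integral>\<^sup>+t\<in>{b..c}. ennreal (v t powr (1 - conjugate_exponent q)) \<partial>lebesgue) (q - 1)
     \<le> ennreal K'" .
  qed
  with q show ?thesis by blast
qed

section \<open>Membership in the classes\<close>

lemma nn_integral_reflect_interval: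
  fixes g :: "real \<Rightarrow> real"
  assumes [measurable]: "g \<in> borel_measurable lebesgue"
  shows "(\<integral>\<^sup>+t\<in>{a..b}. ennreal (g t) \<partial>lebesgue) = (\<integral>\<^sup>+t\<in>{-b..-a}. ennreal (g (- t)) \<partial>lebesgue)"
proof -
  have "(\<integral>\<^sup>+t\<in>{a..b}. ennreal (g t) \<partial>lebesgue)
      = (\<integral>\<^sup>+t. ennreal (g (0 + (-1) * t)) * indicator {a..b} (0 + (-1) * t) \<partial>lebesgue)"
    by (subst nn_integral_real_affine_lebesgue[where c = "-1" and t = 0]) auto
  also have "\<dots> = (\<integral>\<^sup>+t\<in>{-b..-a}. ennreal (g (- t)) \<partial>lebesgue)"
    by (intro nn_integral_cong) (auto simp: indicator_def)
  finally show ?thesis .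
qed

text \<open>The normalization \<open>K \<ge> 1\<close> keeps \<open>level_ratio p K\<close> at most \<open>1\<close>.\<close>

lemma SUP_less_infinity_iff:
  fixes f :: "'a \<Rightarrow> ennreal"
  shows "(SUP x\<in>X. f x) < \<infinity> \<longleftrightarrow> (\<exists>K\<ge>1. \<forall>x\<in>X. f x \<le> ennreal K)"
proof
  assume "(SUP x\<in>X. f x) < \<infinity>"
  then obtain r where r: "(SUP x\<in>X. f x) = ennreal r" "0 \<le> r"
    by (cases "SUP x\<in>X. f x") auto
  have "f x \<le> ennreal (max 1 r)" if "x \<in> X" for x
  proof -
    have "f x \<le> ennreal r"
      using SUP_upper[OF that, of f] r by simp
    also have "\<dots> \<le> ennreal (max 1 r)" by (intro ennreal_leI) simp
    finally show ?thesis .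
  qed
  then show "\<exists>K\<ge>1. \<forall>x\<in>X. f x \<le> ennreal K"
    by (intro exI[of _ "max 1 r"]) auto
next
  assume "\<exists>K\<ge>1. \<forall>x\<in>X. f x \<le> ennreal K"
  then obtain K where "\<forall>x\<in>X. f x \<le> ennreal K" by blast
  then have "(SUP x\<in>X. f x) \<le> ennreal K" by (intro SUP_least) auto
  also have "\<dots> < \<infinity>" by simp
  finally show "(SUP x\<in>X. f x) < \<infinity>" .
qed

text \<open>A version of the weight \<open>w\<close> that is positive on the whole line: the value \<open>1\<close> replaces the
  vanishing values of \<open>w\<close> in \<open>J\<close>, which for a weight form a null set, and all values outside \<open>J\<close>.\<close>

definition positive_version :: "real set \<Rightarrow> (real \<Rightarrow> real) \<Rightarrow> real \<Rightarrow> real" where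
  "positive_version J w t = (if t \<in> J \<and> 0 < w t then w t else 1)"

lemma positive_version_properties:
  assumes w: "weight_on J w" and J: "is_interval J"
  shows "positive_version J w \<in> borel_measurable lebesgue"
    and "0 < positive_version J w t"
    and "a \<in> J \<Longrightarrow> b \<in> J \<Longrightarrow> (\<integral>\<^sup>+t\<in>{a..b}. ennreal (h (positive_version J w t)) \<partial>lebesgue)
      = (\<integral>\<^sup>+t\<in>{a..b}. ennreal (h (w t)) \<partial>lebesgue)"
proof -
  have Jm: "J \<in> sets lebesgue"
    using J real_interval_borel_measurable by (simp add: sets_completionI_sets)
  define g where "g = (\<lambda>t. if t \<in> J then w t else 0)"
  have [measurable]: "g \<in> borel_measurable lebesgue"
    using w Jm unfolding g_def weight_on_def by (intro borel_measurable_if_I) auto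
  have "positive_version J w = (\<lambda>t. if 0 < g t then g t else 1)"
    by (auto simp: positive_version_def g_def)
  also have "\<dots> \<in> borel_measurable lebesgue" by measurable
  finally show "positive_version J w \<in> borel_measurable lebesgue" .
  show "0 < positive_version J w t"
    by (simp add: positive_version_def)
  assume "a \<in> J" "b \<in> J"
  then have sub: "{a..b} \<subseteq> J"
    using J unfolding is_interval_1 by (meson atLeastAtMost_iff subsetI)
  have "AE t in lebesgue. t \<in> J \<longrightarrow> 0 < w t"
    using w Jm unfolding weight_on_def by (subst (asm) AE_restrict_space_iff) auto
  then have "AE t in lebesgue. ennreal (h (positive_version J w t)) * indicator {a..b} t
      = ennreal (h (w t)) * indicator {a..b} t"
    by eventually_elim (use sub in \<open>auto simp: positive_version_def indicator_def\<close>)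
  then show "(\<integral>\<^sup>+t\<in>{a..b}. ennreal (h (positive_version J w t)) \<partial>lebesgue)
      = (\<integral>\<^sup>+t\<in>{a..b}. ennreal (h (w t)) \<partial>lebesgue)"
    by (rule nn_integral_cong_AE)
qed

lemma mem_A_plus_iff:
  assumes J: "is_interval J"
  shows "w \<in> A_plus q J \<longleftrightarrow>
    weight_on J w \<and> (\<exists>K\<ge>1. Ap_bound q J (positive_version J w) K)"
proof (cases "weight_on J w")
  case True
  show ?thesis
    unfolding A_plus_def Ap_bound_def mem_Collect_eq SUP_less_infinity_iff
    using True positive_version_properties(3)[OF True J, of _ _ "\<lambda>x. x"]
      positive_version_properties(3)[OF True J, of _ _ "\<lambda>x. x powr (1 - conjugate_exponent q)"]
    by auto
qed (simp add: A_plus_def)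

lemma mem_A_minus_iff:
  assumes J: "is_interval J"
  shows "w \<in> A_minus q J \<longleftrightarrow>
    weight_on J w \<and> (\<exists>K\<ge>1. Ap_bound q (uminus ` J) (\<lambda>t. positive_version J w (- t)) K)"
proof (cases "weight_on J w")
  case True
  define v where "v = positive_version J w"
  have [measurable]: "v \<in> borel_measurable lebesgue"
    unfolding v_def by (rule positive_version_properties(1)[OF True J])
  have vw: "(\<integral>\<^sup>+t\<in>{a..b}. ennreal (h (w t)) \<partial>lebesgue) = (\<integral>\<^sup>+t\<in>{-b..-a}. ennreal (h (v (- t))) \<partial>lebesgue)"
    if "a \<in> J" "b \<in> J" "h \<in> borel_measurable borel" for a b h
  proof -
    have "(\<lambda>t. h (v t)) \<in> borel_measurable lebesgue"
      using that(3) by measurable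
    then show ?thesis
      using positive_version_properties(3)[OF True J that(1,2), of h] nn_integral_reflect_interval[of "\<lambda>t. h (v t)" a b]
      by (simp add: v_def)
  qed
  have iff: "(\<forall>x\<in>{(a, b, c). a \<in> J \<and> b \<in> J \<and> c \<in> J \<and> a < b \<and> b < c}.
      (case x of (a, b, c) \<Rightarrow> ennreal (1 / (c - a) powr q)
        * (\<integral>\<^sup>+t\<in>{b..c}. ennreal (w t) \<partial>lebesgue)
        * ennreal_powr (\<integral>\<^sup>+t\<in>{a..b}. ennreal (w t powr (1 - conjugate_exponent q)) \<partial>lebesgue) (q - 1))
      \<le> ennreal K) \<longleftrightarrow> Ap_bound q (uminus ` J) (\<lambda>t. v (- t)) K" for K
  proof -
    have "(\<forall>x\<in>{(a, b, c). a \<in> J \<and> b \<in> J \<and> c \<in> J \<and> a < b \<and> b < c}.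
      (case x of (a, b, c) \<Rightarrow> ennreal (1 / (c - a) powr q)
        * (\<integral>\<^sup>+t\<in>{b..c}. ennreal (w t) \<partial>lebesgue)
        * ennreal_powr (\<integral>\<^sup>+t\<in>{a..b}. ennreal (w t powr (1 - conjugate_exponent q)) \<partial>lebesgue) (q - 1))
      \<le> ennreal K) \<longleftrightarrow> (\<forall>c\<in>J. \<forall>b\<in>J. \<forall>a\<in>J. - c < - b \<longrightarrow> - b < - a \<longrightarrow>
      ennreal (1 / (- a - - c) powr q)
        * (\<integral>\<^sup>+t\<in>{- c..- b}. ennreal (v (- t)) \<partial>lebesgue)
        * ennreal_powr (\<integral>\<^sup>+t\<in>{- b..- a}. ennreal (v (- t) powr (1 - conjugate_exponent q)) \<partial>lebesgue) (q - 1)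
      \<le> ennreal K)"
      using vw[of _ _ "\<lambda>x. x"] vw[of _ _ "\<lambda>x. x powr (1 - conjugate_exponent q)"] by auto
    also have "\<dots> \<longleftrightarrow> Ap_bound q (uminus ` J) (\<lambda>t. v (- t)) K"
      unfolding Ap_bound_def by simp
    finally show ?thesis .
  qed
  show ?thesis
    unfolding A_minus_def mem_Collect_eq SUP_less_infinity_iff iff using True by (simp add: v_def)
qed (simp add: A_minus_def)

section \<open>Openness of the classes\<close>

theorem lemma2p5:
  fixes p :: real and J :: "real set" and w :: "real \<Rightarrow> real"
  assumes "1 < p"
    and "J = {..0} \<or> J = {0..}"
  shows "(w \<in> A_plus p J \<longrightarrow> Inf {q. 1 < q \<and> w \<in> A_plus q J} < p) \<and>
         (w \<in> A_minus p J \<longrightarrow> Inf {q. 1 < q \<and> w \<in> A_minus q J} < p)"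
proof -
  have J: "is_interval J"
    using assms(2) is_interval_ic is_interval_ci by blast
  then have J': "is_interval (uminus ` J)"
    by simp
  have Inf_less: "Inf {q. 1 < q \<and> P q} < p" if "1 < q" "q < p" "P q" for q and P :: "real \<Rightarrow> bool"
    using that by (subst cInf_less_iff) (auto intro!: bdd_belowI[of _ 1])
  have mono: "\<exists>K\<ge>1. Ap_bound q J v K" if "Ap_bound q J v K" for q J v K
  proof -
    have "ennreal K \<le> ennreal (max 1 K)"
      by (intro ennreal_leI) simp
    then have "Ap_bound q J v (max 1 K)"
      using that unfolding Ap_bound_def by (meson order_trans)
    then show ?thesis
      by (intro exI[of _ "max 1 K"]) simp
  qed
  show ?thesis
  proof (intro conjI impI)
    assume "w \<in> A_plus p J"
    then obtain K where w: "weight_on J w" and K: "1 \<le> K" "Ap_bound p J (positive_version J w) K"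
      using mem_A_plus_iff[OF J] by blast
    then obtain q K' where "1 < q" "q < p" "Ap_bound q J (positive_version J w) K'"
      using Ap_bound_self_improvement[OF K(2) positive_version_properties(1,2)[OF w J] assms(1) K(1) J] by blast
    then show "Inf {q. 1 < q \<and> w \<in> A_plus q J} < p"
      using w mono mem_A_plus_iff[OF J] by (intro Inf_less[of q]) blast+
  next
    assume "w \<in> A_minus p J"
    then obtain K where w: "weight_on J w" and K: "1 \<le> K"
        "Ap_bound p (uminus ` J) (\<lambda>t. positive_version J w (- t)) K"
      using mem_A_minus_iff[OF J] by blast
    have "(\<lambda>t. positive_version J w (- t)) \<in> borel_measurable lebesgue"
      using measurable_compose[OF lebesgue_measurable_scaling[of "-1"] positive_version_properties(1)[OF w J]]
      by simp
    then obtain q K' where "1 < q" "q < p" "Ap_bound q (uminus ` J) (\<lambda>t. positive_version J w (- t)) K'"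
      using Ap_bound_self_improvement[OF K(2) _ positive_version_properties(2)[OF w J] assms(1) K(1) J'] by blast
    then show "Inf {q. 1 < q \<and> w \<in> A_minus q J} < p"
      using w mono mem_A_minus_iff[OF J] by (intro Inf_less[of q]) blast+
  qed
qed

end
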